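(* Let $H\le F$ be a non-trivial subgroup, let $T$ be a geodesic spanning tree (with respect to $o=H$) of the Schreier graph $X=H\backslash F$, and let $\Omega$ be the associated Schreier limit set. Let $\Lambda,\Lambda^{rad},\Lambda^{horS},\Lambda^{horB}$ be the full, radial, small horospheric and big horospheric limit sets of $H$, and let $$\Sigma=\Bigl\{\omega\in\partial F:\ \sum_{h\in H}(2m-1)^{-b_\omega(h)}=\infty\Bigr\}.$$ Then $$\Lambda^{rad}\subset\Lambda^{horS}\subset\Omega\subset\Lambda^{horB}\subset\Sigma\subset\Lambda .$$
   Context: $F$ is the free group freely generated by a finite set $\mathcal A$ with $|\mathcal A|=m\ge 2$; $\breve{\mathcal A}=\mathcal A\sqcup\mathcal A^{-1}$. Elements $g\in F$ are identified with finite freely reduced words in $\breve{\mathcal A}$, $|g|$ is the length, and $d(g,g')=|g^{-1}g'|$ is the distance in the Cayley graph of $F$ (a $2m$-regular tree). $\partial F$ is the set of infinite freely reduced words with the product topology; $g_n\in F$ converges to $\omega\in\partial F$ iff the reduced words of $g_n$ converge pointwise to $\omega$, which defines the compactification $\widehat F=F\cup\partial F$. Busemann function: for $\omega\in\partial F$, $b_\omega(g)=|g|-2(g|\omega)$, where $(g|\omega)$ is the length of the longest common initial segment of the words $g$ and $\omega$; equivalently $b_\omega(g)=\lim_n[d(g,[\omega]_n)-n]$, where $[\omega]_n$ is the initial segment of $\omega$ of length $n$. Horoballs centered at $\omega$ are the sets $\{g'\in F: b_\omega(g')\le b_\omega(g)\}$, $g\in F$. Limit sets of $H$: $\Lambda$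 is the set of all points of $\partial F$ that are limit points of $H$ in $\widehat F$. $\Lambda^{rad}$ is the set of all accumulation points in $\partial F$ of sequences of elements of $H$ which stay within a tubular (bounded) neighbourhood of a certain geodesic ray in $F$. $\Lambda^{horS}$ (resp. $\Lambda^{horB}$) is the set of $\omega\in\partial F$ such that any (resp. a certain) horoball centered at $\omega$ contains infinitely many points of $H$; that is, for any (resp. a certain) $N\in\mathbb Z$ there are infinitely many $h\in H$ with $b_\omega(h)\le N$. Schreier limit set: $X=H\backslash F$ has the cosets $Hg$ as vertices and, for each vertex $x$ and $a\in\breve{\mathcal A}$, an oriented edge from $x$ to $xa$ labelled $a$, whose reversal is the edge from $xa$ to $x$ labelled $a^{-1}$ (loops and multiple edges allowed); $o=H$. A spanning tree $T$ is geodesic if $d_T(o,x)=d_X(o,x)$ for all $x$. For every oriented edge $\mathcal E=[x,y]$ of $X$ not in $T$, $s_{\mathcal E}\in H$ is the element read along the path going from $o$ to $x$ in $T$, along $[x,y]$, and from $y$ to $o$ in $T$. The set $\breve{\mathcal S}$ of all $s_{\mathcal E}$ equals $\mathcal S\sqcup\mathcal S^{-1}$ with $\mathcal S$ (edges with label in $\mathcal A$) a free generating set of $H$. For each infinite freely reduced word $\xi=s_1s_2\dots$ in $\breve{\mathcal S}$ the limit $\sigma^\infty(\xi)=\lim_n s_1\cdots s_n\in\partial F$ exists, and $\Omega$ is the set of all these limits. *)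

theory Defs
  imports
    "HOL-Analysis.Analysis"
    "HOL-Algebra.Coset"
    "Graph_Theory.Digraph_Component"
begin

section \<open>The free group on a finite alphabet\<close>

text \<open>
  The alphabet is the type \<open>'a\<close>; the letter \<open>(a, True)\<close> stands for the generator \<open>a\<close> and
  \<open>(a, False)\<close> for its inverse. The free group is modelled by the freely reduced words.
\<close>

type_synonym 'a letter = "'a \<times> bool"
type_synonym 'a word = "'a letter list"

definition inv_letter :: "'a letter \<Rightarrow> 'a letter" where
  "inv_letter x = (fst x, \<not> snd x)"

definition reduced :: "'a word \<Rightarrow> bool" where
  "reduced w \<longleftrightarrow> successively (\<lambda>x y. y \<noteq> inv_letter x) w"

fun push :: "'a letter \<Rightarrow> 'a word \<Rightarrow> 'a word" where
  "push x [] = [x]"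
| "push x (y # w) = (if y = inv_letter x then w else x # y # w)"

definition reduce :: "'a word \<Rightarrow> 'a word" where
  "reduce w = foldr push w []"

definition free_group :: "'a word monoid" where
  "free_group = \<lparr>carrier = {w. reduced w}, monoid.mult = (\<lambda>u v. reduce (u @ v)), one = []\<rparr>"

lemma inv_letter_inv_letter [simp]: "inv_letter (inv_letter x) = x"
  by (simp add: inv_letter_def)

lemma inv_letter_neq [simp]: "inv_letter x \<noteq> x"
  by (cases x) (auto simp: inv_letter_def)

lemma reduced_Cons: "reduced (x # w) \<longleftrightarrow> reduced w \<and> (w \<noteq> [] \<longrightarrow> hd w \<noteq> inv_letter x)"
  by (auto simp: reduced_def successively_Cons)

lemma reduced_push: "reduced w \<Longrightarrow> reduced (push x w)"
  by (cases "(x, w)" rule: push.cases) (auto simp: reduced_Cons)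

lemma reduced_foldr_push: "reduced v \<Longrightarrow> reduced (foldr push u v)"
  by (induction u) (auto intro: reduced_push)

lemma reduced_reduce [simp]: "reduced (reduce w)"
  unfolding reduce_def by (rule reduced_foldr_push) (simp add: reduced_def)

lemma reduce_reduced: "reduced w \<Longrightarrow> reduce w = w"
proof (induction w)
  case (Cons x w)
  then show ?case by (cases w) (auto simp: reduce_def reduced_Cons)
qed (simp add: reduce_def)

lemma push_push_inv: "reduced w \<Longrightarrow> push x (push (inv_letter x) w) = w"
  by (cases w; cases "tl w") (auto simp: reduced_Cons)

lemma foldr_push_push:
  assumes "reduced v" shows "foldr push (push x u) v = push x (foldr push u v)"
proof (cases u)
  case (Cons y u')
  show ?thesis
    using push_push_inv[OF reduced_foldr_push[OF assms, of u'], of x] Cons by auto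
qed simp

lemma foldr_push_reduce: "reduced v \<Longrightarrow> foldr push (reduce u) v = foldr push u v"
  unfolding reduce_def by (induction u) (auto simp: foldr_push_push)

lemma reduce_append_left: "reduce (reduce u @ v) = reduce (u @ v)"
proof -
  have "reduced (foldr push v [])" by (rule reduced_foldr_push) (simp add: reduced_def)
  from foldr_push_reduce[OF this, of u] show ?thesis by (simp add: reduce_def)
qed

lemma reduce_append_right: "reduce (u @ reduce v) = reduce (u @ v)"
  using reduce_reduced[OF reduced_reduce, of v] by (simp add: reduce_def)

lemma reduce_inverse: "reduce (rev (map inv_letter w) @ w) = []"
proof (induction w)
  case (Cons x w)
  have "reduce (rev (map inv_letter (x # w)) @ x # w)
      = reduce (rev (map inv_letter w) @ reduce (inv_letter x # x # w))"
    by (simp add: reduce_append_right)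
  also have "reduce (inv_letter x # x # w) = reduce w"
    using push_push_inv[OF reduced_reduce, of "inv_letter x" w] by (simp add: reduce_def)
  finally show ?case using Cons by (simp add: reduce_append_right)
qed (simp add: reduce_def)

lemma reduced_inverse:
  assumes "reduced w" shows "reduced (rev (map inv_letter w))"
  using assms unfolding reduced_def successively_rev successively_map
  by (rule successively_mono) (metis inv_letter_inv_letter)

lemma group_free_group: "group free_group"
proof (rule groupI)
  fix u v w :: "'a word"
  show "u \<otimes>\<^bsub>free_group\<^esub> v \<otimes>\<^bsub>free_group\<^esub> w = u \<otimes>\<^bsub>free_group\<^esub> (v \<otimes>\<^bsub>free_group\<^esub> w)"
    by (simp add: free_group_def reduce_append_left reduce_append_right)
next
  fix w :: "'a word" assume "w \<in> carrier free_group"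
  then show "\<exists>v\<in>carrier free_group. v \<otimes>\<^bsub>free_group\<^esub> w = \<one>\<^bsub>free_group\<^esub>"
    by (intro bexI[of _ "rev (map inv_letter w)"])
      (simp_all add: free_group_def reduce_inverse reduced_inverse)
qed (simp_all add: free_group_def reduce_reduced reduced_def[of "[]"])

lemma inv_free_group:
  assumes "w \<in> carrier free_group" shows "inv\<^bsub>free_group\<^esub> w = rev (map inv_letter w)"
  using assms group.inv_equality[OF group_free_group, of "rev (map inv_letter w)" w]
  by (simp add: free_group_def reduce_inverse reduced_inverse)

definition free_dist :: "'a word \<Rightarrow> 'a word \<Rightarrow> nat" where
  "free_dist g g' = length (inv\<^bsub>free_group\<^esub> g \<otimes>\<^bsub>free_group\<^esub> g')"


section \<open>Boundary and compactification\<close>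

definition boundary :: "(nat \<Rightarrow> 'a letter) set" where
  "boundary = {\<omega>. \<forall>n. \<omega> (Suc n) \<noteq> inv_letter (\<omega> n)}"

text \<open>
  A finite word is padded with \<open>None\<close>, so that finite and infinite words become points of
  one product of discrete spaces, whose topology is that of pointwise convergence.
\<close>

definition word_point :: "'a word \<Rightarrow> nat \<Rightarrow> 'a letter option" where
  "word_point g = (\<lambda>n. if n < length g then Some (g ! n) else None)"

definition end_point :: "(nat \<Rightarrow> 'a letter) \<Rightarrow> nat \<Rightarrow> 'a letter option" where
  "end_point \<omega> = (\<lambda>n. Some (\<omega> n))"

definition compactification :: "(nat \<Rightarrow> 'a letter option) topology" where
  "compactification =
    subtopology (product_topology (\<lambda>_. discrete_topology UNIV) UNIV)
      (word_point ` carrier free_group \<union> end_point ` boundary)"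


section \<open>Busemann functions and horoballs\<close>

definition confluent_length :: "'a word \<Rightarrow> (nat \<Rightarrow> 'a letter) \<Rightarrow> nat" where
  "confluent_length g \<omega> = Max {k. k \<le> length g \<and> take k g = map \<omega> [0..<k]}"

definition busemann :: "(nat \<Rightarrow> 'a letter) \<Rightarrow> 'a word \<Rightarrow> int" where
  "busemann \<omega> g = int (length g) - 2 * int (confluent_length g \<omega>)"

definition horoball :: "(nat \<Rightarrow> 'a letter) \<Rightarrow> 'a word \<Rightarrow> 'a word set" where
  "horoball \<omega> g = {g' \<in> carrier free_group. busemann \<omega> g' \<le> busemann \<omega> g}"


section \<open>Limit sets of a subgroup\<close>

definition limit_set :: "'a word set \<Rightarrow> (nat \<Rightarrow> 'a letter) set" where
  "limit_set H = {\<omega> \<in> boundary. end_point \<omega> \<in> compactification derived_set_of (word_point ` H)}"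

definition geodesic_ray :: "(nat \<Rightarrow> 'a word) \<Rightarrow> bool" where
  "geodesic_ray \<gamma> \<longleftrightarrow> (\<forall>n. \<gamma> n \<in> carrier free_group) \<and>
    (\<forall>i j. int (free_dist (\<gamma> i) (\<gamma> j)) = \<bar>int i - int j\<bar>)"

definition accumulation_end :: "(nat \<Rightarrow> 'a word) \<Rightarrow> (nat \<Rightarrow> 'a letter) \<Rightarrow> bool" where
  "accumulation_end h \<omega> \<longleftrightarrow>
    (\<forall>U. openin compactification U \<and> end_point \<omega> \<in> U \<longrightarrow> infinite {n. word_point (h n) \<in> U})"

definition radial_limit_set :: "'a word set \<Rightarrow> (nat \<Rightarrow> 'a letter) set" where
  "radial_limit_set H = {\<omega> \<in> boundary. \<exists>\<gamma> h R. geodesic_ray \<gamma> \<and> range h \<subseteq> H \<and>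
    (\<forall>n. \<exists>k. free_dist (h n) (\<gamma> k) \<le> R) \<and> accumulation_end h \<omega>}"

definition small_horospheric_limit_set :: "'a word set \<Rightarrow> (nat \<Rightarrow> 'a letter) set" where
  "small_horospheric_limit_set H =
    {\<omega> \<in> boundary. \<forall>g\<in>carrier free_group. infinite (H \<inter> horoball \<omega> g)}"

definition big_horospheric_limit_set :: "'a word set \<Rightarrow> (nat \<Rightarrow> 'a letter) set" where
  "big_horospheric_limit_set H =
    {\<omega> \<in> boundary. \<exists>g\<in>carrier free_group. infinite (H \<inter> horoball \<omega> g)}"

text \<open>The sum is taken in \<open>ennreal\<close>, where every family is summable.\<close>

definition divergence_set :: "('a::finite) word set \<Rightarrow> (nat \<Rightarrow> 'a letter) set" where
  "divergence_set H = {\<omega> \<in> boundary.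
    (\<Sum>\<^sub>\<infinity>h\<in>H. ennreal ((2 * real CARD('a) - 1) powi (- busemann \<omega> h))) = \<infinity>}"


section \<open>Schreier graph and Schreier limit set\<close>

text \<open>The edge \<open>(x, a)\<close> is the edge labelled \<open>a\<close> from the coset \<open>x\<close> to the coset \<open>x a\<close>.\<close>

type_synonym 'a edge = "'a word set \<times> 'a letter"
type_synonym 'a schreier = "('a word set, 'a edge) pre_digraph"

definition schreier_graph :: "'a word set \<Rightarrow> 'a schreier" where
  "schreier_graph H = \<lparr>verts = rcosets\<^bsub>free_group\<^esub> H, arcs = (rcosets\<^bsub>free_group\<^esub> H) \<times> UNIV,
    tail = fst, head = (\<lambda>(x, a). x #>\<^bsub>free_group\<^esub> [a])\<rparr>"

lemma wf_digraph_schreier_graph: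
  assumes "subgroup H free_group" shows "wf_digraph (schreier_graph H)"
proof -
  interpret group free_group by (rule group_free_group)
  have H: "H \<subseteq> carrier free_group" using assms by (rule subgroup.subset)
  have letter: "[a] \<in> carrier free_group" for a :: "'a letter"
    by (simp add: free_group_def reduced_def)
  have "x #>\<^bsub>free_group\<^esub> [a] \<in> rcosets\<^bsub>free_group\<^esub> H" if "x \<in> rcosets\<^bsub>free_group\<^esub> H" for x a
    using that H letter[of a] by (auto simp: RCOSETS_def coset_mult_assoc intro!: bexI)
  then show ?thesis
    by unfold_locales (auto simp: schreier_graph_def)
qed

definition edge_rev :: "'a edge \<Rightarrow> 'a edge" where
  "edge_rev = (\<lambda>(x, a). (x #>\<^bsub>free_group\<^esub> [a], inv_letter a))"

text \<open>
  A geometric edge is a pair of mutually reversed arcs. Hence subtrees are closed under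
  reversal, for such graphs strong connectivity is connectivity, and the only directed cycles
  of a tree are the backtrackings along one edge. (The library's \<open>tree\<close> would forbid these.)
\<close>

definition spanning_subtree :: "'a schreier \<Rightarrow> 'a schreier \<Rightarrow> bool" where
  "spanning_subtree T X \<longleftrightarrow> spanning T X \<and> (\<forall>e\<in>arcs T. edge_rev e \<in> arcs T) \<and>
    strongly_connected T \<and> (\<forall>p. pre_digraph.cycle T p \<longrightarrow> (\<exists>e. p = [e, edge_rev e]))"

definition graph_dist :: "('v, 'e) pre_digraph \<Rightarrow> 'v \<Rightarrow> 'v \<Rightarrow> nat" where
  "graph_dist G u v = (LEAST n. \<exists>p. pre_digraph.awalk G u p v \<and> length p = n)"

text \<open>The base point \<open>o\<close> is the coset \<open>H\<close> itself.\<close>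

definition geodesic_spanning_tree :: "'a word set \<Rightarrow> 'a schreier \<Rightarrow> bool" where
  "geodesic_spanning_tree H T \<longleftrightarrow> spanning_subtree T (schreier_graph H) \<and>
    (\<forall>x\<in>verts (schreier_graph H). graph_dist T H x = graph_dist (schreier_graph H) H x)"

definition tree_path :: "'a schreier \<Rightarrow> 'a word set \<Rightarrow> 'a word set \<Rightarrow> 'a edge list" where
  "tree_path T x y = (THE p. pre_digraph.apath T x p y)"

definition schreier_generator :: "'a word set \<Rightarrow> 'a schreier \<Rightarrow> 'a edge \<Rightarrow> 'a word" where
  "schreier_generator H T e = reduce (map snd
    (tree_path T H (tail (schreier_graph H) e) @ [e] @ tree_path T (head (schreier_graph H) e) H))"

definition schreier_generators :: "'a word set \<Rightarrow> 'a schreier \<Rightarrow> 'a word set" where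
  "schreier_generators H T = schreier_generator H T ` (arcs (schreier_graph H) - arcs T)"

primrec partial_product :: "(nat \<Rightarrow> 'a word) \<Rightarrow> nat \<Rightarrow> 'a word" where
  "partial_product s 0 = \<one>\<^bsub>free_group\<^esub>"
| "partial_product s (Suc n) = partial_product s n \<otimes>\<^bsub>free_group\<^esub> s n"

text \<open>
  Since \<open>schreier_generators H T\<close> is the disjoint union of a free generating set and its
  inverses, its formal letters are identified with the group elements they denote.
\<close>

definition schreier_limit_set :: "'a word set \<Rightarrow> 'a schreier \<Rightarrow> (nat \<Rightarrow> 'a letter) set" where
  "schreier_limit_set H T = {\<omega> \<in> boundary. \<exists>s.
    (\<forall>n. s n \<in> schreier_generators H T) \<and>
    (\<forall>n. s (Suc n) \<noteq> inv\<^bsub>free_group\<^esub> (s n)) \<and>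
    limitin compactification (\<lambda>n. word_point (partial_product s n)) (end_point \<omega>) sequentially}"

end

theory Submission
  imports Defs
begin

text \<open>
  Write \<open>t g\<close> for the word read in the tree from the base point to the coset \<open>H g\<close>; as the tree is
  geodesic, it is a shortest element of \<open>H g\<close>. It extends along tree edges, so a boundary point lies
  in the Schreier limit set iff its path in the Schreier graph leaves the tree infinitely often. If
  it does, returning to the base point after each crossing gives elements of \<open>H\<close> at which the Busemann
  function is at most \<open>0\<close>; if it does not, the path eventually moves away from \<open>H\<close> at unit
  speed and the Busemann function is bounded below on \<open>H\<close>. The two outer inclusions compare Busemann
  functions with distances: along a geodesic ray for radial points, and, off the limit set, through a
  cylinder whose translates cover each point boundedly often, so that the total measure of the
  translates bounds the Poincare series.
\<close>

subsection \<open>Reduced words\<close>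

text \<open>Horospheric conditions become metric ones through an exact identity: once
  \<open>n\<close> is at least the length of \<open>g\<close>, the distance from \<open>g\<close> to
  any reduced word sharing the first \<open>n\<close> letters of \<open>\<omega>\<close> is the
  length of that word plus \<open>busemann \<omega> g\<close>. Lower bounds for the Busemann
  function on \<open>H\<close> are thus lower bounds for lengths in one coset, which a geodesic tree
  controls. The delicate point is cancellation. A letter read on an edge outside the tree never
  cancels against neighbouring tree letters, because the tree contains each edge together with its
  reversal; two such letters with no tree letter between them cancel only for mutually reversed
  edges, whose generators are inverse to each other. Big horospheric points lie in the divergence
  set because a horoball contributes infinitely many terms bounded away from zero.\<close>

definition winv :: "'a word \<Rightarrow> 'a word" where
  "winv w = rev (map inv_letter w)"

lemma winv_Nil [simp]: "winv [] = []"
  and winv_Cons: "winv (a # w) = winv w @ [inv_letter a]"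
  and winv_append: "winv (u @ v) = winv v @ winv u"
  and winv_winv [simp]: "winv (winv w) = w"
  and length_winv [simp]: "length (winv w) = length w"
  and winv_eq_Nil_iff [simp]: "winv w = [] \<longleftrightarrow> w = []"
  by (simp_all add: winv_def rev_map comp_def)

lemma reduced_winv: "reduced w \<Longrightarrow> reduced (winv w)"
  by (simp add: winv_def reduced_inverse)

lemma reduced_Nil [simp]: "reduced []"
  by (simp add: reduced_def)

lemma reduced_append:
  "reduced (u @ v) \<longleftrightarrow> reduced u \<and> reduced v \<and> (u \<noteq> [] \<and> v \<noteq> [] \<longrightarrow> hd v \<noteq> inv_letter (last u))"
  by (auto simp: reduced_def successively_append_iff)

lemma reduced_drop: "reduced w \<Longrightarrow> reduced (drop n w)"
  by (metis append_take_drop_id reduced_append)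

lemma length_reduce_le: "length (reduce w) \<le> length w"
proof (induction w)
  case (Cons a w)
  have "length (push a v) \<le> Suc (length v)" for v :: "'a word"
    by (cases v) auto
  from this[of "reduce w"] Cons show ?case by (simp add: reduce_def)
qed (simp add: reduce_def)

lemma reduce_append_mid: "reduce (u @ reduce v @ w) = reduce (u @ v @ w)"
  by (metis reduce_append_left reduce_append_right)

lemma reduce_Cons_right: "reduce (a # reduce w) = reduce (a # w)"
  using reduce_append_right[of "[a]" w] by simp

lemma reduce_winv_left: "reduce (winv w @ w) = []"
  by (simp add: winv_def reduce_inverse)

lemma reduce_winv_right: "reduce (w @ winv w) = []"
  using reduce_winv_left[of "winv w"] by simp

lemma reduce_cancel_left: "reduce (u @ winv w @ w @ v) = reduce (u @ v)"
  by (metis append.left_neutral append.assoc reduce_append_mid reduce_winv_left)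

lemma reduce_cancel_right: "reduce (u @ w @ winv w @ v) = reduce (u @ v)"
  using reduce_cancel_left[of u "winv w" v] by simp

lemma reduce_Nil [simp]: "reduce [] = []"
  by (simp add: reduce_def)

text \<open>Group computations take place on unreduced words: these rules leave one outer
  \<open>reduce\<close> and delete adjacent inverse blocks. The instances with an empty factor cover
  blocks at either end, where the general patterns do not match.\<close>

lemmas reduce_simps = reduce_append_left reduce_append_right reduce_append_mid reduce_Cons_right
  reduce_winv_left reduce_winv_right reduce_cancel_left reduce_cancel_right
  reduce_cancel_left[of "[]", simplified] reduce_cancel_right[of "[]", simplified]
  reduce_cancel_left[of _ _ "[]", simplified] reduce_cancel_right[of _ _ "[]", simplified]

lemma reduce_winv_cong:
  assumes "reduce u = reduce v" shows "reduce (winv u) = reduce (winv v)"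
proof -
  have "reduce (winv u) = reduce (winv v @ reduce v @ winv u)"
    by (simp add: reduce_simps)
  also have "\<dots> = reduce (winv v @ reduce u @ winv u)" using assms by simp
  also have "\<dots> = reduce (winv v)" by (simp add: reduce_simps)
  finally show ?thesis .
qed

lemma winv_reduce: "winv (reduce w) = reduce (winv w)"
  by (metis reduce_winv_cong reduce_reduced reduced_reduce reduced_winv)

lemma reduce_winv_append_eq_Nil:
  assumes "reduce (winv u @ v) = []" "reduced u" "reduced v" shows "u = v"
proof -
  have "u = reduce (u @ reduce (winv u @ v))" using assms by (simp add: reduce_reduced)
  also have "\<dots> = reduce v" by (simp only: reduce_simps)
  finally show ?thesis using assms by (simp add: reduce_reduced)
qed

lemma common_prefix:
  obtains p u' v' where "u = p @ u'" "v = p @ v'" "u' = [] \<or> v' = [] \<or> hd u' \<noteq> hd v'"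
proof -
  have "\<exists>p u' v'. u = p @ u' \<and> v = p @ v' \<and> (u' = [] \<or> v' = [] \<or> hd u' \<noteq> hd v')"
  proof (induction u arbitrary: v)
    case (Cons a u)
    show ?case
    proof (cases "v \<noteq> [] \<and> hd v = a")
      case True
      then obtain v0 where v: "v = a # v0" by (cases v) auto
      from Cons[of v0] obtain p u' v' where "u = p @ u'" "v0 = p @ v'"
        "u' = [] \<or> v' = [] \<or> hd u' \<noteq> hd v'" by blast
      then show ?thesis using v by (intro exI[of _ "a # p"] exI[of _ u'] exI[of _ v']) auto
    next
      case False
      then show ?thesis by (intro exI[of _ "[]"] exI[of _ "a # u"] exI[of _ v]) auto
    qed
  qed auto
  then show ?thesis using that by blast
qed

lemma reduced_winv_append:
  assumes "reduced u" "reduced v" "u = [] \<or> v = [] \<or> hd u \<noteq> hd v"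
  shows "reduced (winv u @ v)"
  using assms by (auto simp: reduced_append reduced_inverse winv_def last_rev hd_map)

text \<open>The cancelling block \<open>c\<close> is the longest common prefix of
  \<open>winv u\<close> and \<open>v\<close>; past it the first letters differ, so nothing further
  cancels.\<close>

lemma cancellation:
  assumes "reduced u" "reduced v"
  obtains p c q where "u = p @ winv c" "v = c @ q" "reduced (p @ q)"
proof -
  obtain c u' v' where *: "winv u = c @ u'" "v = c @ v'" "u' = [] \<or> v' = [] \<or> hd u' \<noteq> hd v'"
    by (rule common_prefix)
  have u: "u = winv u' @ winv c" using *(1) winv_append by (metis winv_winv)
  have "reduced u'" "reduced v'"
    using assms *(1,2) reduced_winv[of u] by (auto simp: reduced_append)
  with *(3) have "reduced (winv u' @ v')" by (intro reduced_winv_append)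
  with u *(2) show ?thesis by (intro that)
qed

lemma free_group_simps [simp]:
  "w \<in> carrier free_group \<longleftrightarrow> reduced w"
  "u \<otimes>\<^bsub>free_group\<^esub> v = reduce (u @ v)"
  "\<one>\<^bsub>free_group\<^esub> = []"
  by (simp_all add: free_group_def)

lemma inv_free_group_winv: "reduced w \<Longrightarrow> inv\<^bsub>free_group\<^esub> w = winv w"
  by (simp add: inv_free_group winv_def)

lemma free_dist_eq: "reduced g \<Longrightarrow> free_dist g g' = length (reduce (winv g @ g'))"
  by (simp add: free_dist_def inv_free_group_winv)

lemma free_dist_commute:
  assumes "reduced g" "reduced g'" shows "free_dist g g' = free_dist g' g"
proof -
  have "reduce (winv g' @ g) = winv (reduce (winv g @ g'))"
    by (simp add: winv_reduce winv_append)
  then show ?thesis using assms by (simp add: free_dist_eq)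
qed

lemma free_dist_triangle:
  assumes "reduced a" "reduced b" "reduced c"
  shows "free_dist a c \<le> free_dist a b + free_dist b c"
proof -
  have "reduce (winv a @ c) = reduce (reduce (winv a @ b) @ reduce (winv b @ c))"
    by (simp add: reduce_simps)
  with length_reduce_le[of "reduce (winv a @ b) @ reduce (winv b @ c)"] show ?thesis
    using assms by (simp add: free_dist_eq)
qed

lemma free_dist_Nil: "reduced g \<Longrightarrow> free_dist [] g = length g"
  by (simp add: free_dist_eq reduce_reduced)

locale free_subgroup =
  fixes H :: "'a word set"
  assumes subgroup: "subgroup H free_group"
begin

lemma reduced_mem: "h \<in> H \<Longrightarrow> reduced h"
  using subgroup.subset[OF subgroup] by (auto simp: subset_iff)

lemma Nil_closed [simp]: "[] \<in> H"
  using subgroup.one_closed[OF subgroup] by simp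

lemma mult_closed: "h \<in> H \<Longrightarrow> h' \<in> H \<Longrightarrow> reduce (h @ h') \<in> H"
  using subgroup.m_closed[OF subgroup] by simp

lemma winv_closed: "h \<in> H \<Longrightarrow> winv h \<in> H"
  using subgroup.m_inv_closed[OF subgroup] inv_free_group_winv reduced_mem by metis

end


subsection \<open>Boundary points and Busemann functions\<close>

abbreviation initial :: "(nat \<Rightarrow> 'b) \<Rightarrow> nat \<Rightarrow> 'b list" where
  "initial \<omega> n \<equiv> map \<omega> [0..<n]"

lemma take_initial: "k \<le> n \<Longrightarrow> take k (initial \<omega> n) = initial \<omega> k"
  by (simp add: take_map)

lemma take_eq_initial_mono:
  assumes "take n g = initial \<omega> n" "k \<le> n" shows "take k g = initial \<omega> k"
proof -
  have "take k g = take k (take n g)" using assms(2) by (simp add: min_def)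
  then show ?thesis using assms by (simp add: take_initial)
qed

lemma take_eq_initial_length: "take n g = initial \<omega> n \<Longrightarrow> n \<le> length g"
  by (metis diff_zero length_map length_take length_upt min.cobounded1)

lemma reduced_initial:
  assumes "\<omega> \<in> boundary" shows "reduced (initial \<omega> n)"
proof (induction n)
  case (Suc n)
  have "last (initial \<omega> n) = \<omega> (n - 1)" "n > 0" if "n \<noteq> 0" using that by (auto simp: last_map)
  with Suc show ?case using assms
    by (cases n) (auto simp: reduced_append boundary_def reduced_Cons)
qed simp

lemma confluent_length_set:
  "finite {k. k \<le> length g \<and> take k g = initial \<omega> k}" "0 \<in> {k. k \<le> length g \<and> take k g = initial \<omega> k}"
  by (auto intro: finite_subset[of _ "{..length g}"])

lemma confluent_length:
  "confluent_length g \<omega> \<le> length g" "take (confluent_length g \<omega>) g = initial \<omega> (confluent_length g \<omega>)"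
  using Max_in[OF confluent_length_set(1)[of g \<omega>]] confluent_length_set(2)[of g \<omega>]
  unfolding confluent_length_def by blast+

lemma confluent_length_ge:
  "take k g = initial \<omega> k \<Longrightarrow> k \<le> confluent_length g \<omega>"
  unfolding confluent_length_def
  by (intro Max_ge confluent_length_set) (auto dest: take_eq_initial_length)

lemma confluent_length_initial [simp]: "confluent_length (initial \<omega> n) \<omega> = n"
  using confluent_length(1)[of "initial \<omega> n" \<omega>] confluent_length_ge[of n "initial \<omega> n" \<omega>] by simp

lemma busemann_initial [simp]: "busemann \<omega> (initial \<omega> n) = - int n"
  by (simp add: busemann_def)

text \<open>Once the common prefix of \<open>g\<close> and \<open>g'\<close> is cancelled, the
  remaining quotient is already reduced. The bound on the length of \<open>g\<close> puts the
  branching point inside the part that \<open>g'\<close> shares with \<open>\<omega>\<close>, so the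
  limit describing the Busemann function is attained.\<close>

lemma free_dist_busemann:
  assumes "reduced g" "reduced g'" "take n g' = initial \<omega> n" "length g \<le> n"
  shows "int (free_dist g g') = busemann \<omega> g + int (length g')"
proof -
  define c where "c = confluent_length g \<omega>"
  have c: "c \<le> length g" "take c g = initial \<omega> c" using confluent_length[of g \<omega>] by (auto simp: c_def)
  have g': "take c g' = initial \<omega> c" "n \<le> length g'"
    using assms c(1) take_eq_initial_mono[of n g' \<omega> c] take_eq_initial_length by auto
  have dist: "drop c g = [] \<or> drop c g' = [] \<or> hd (drop c g) \<noteq> hd (drop c g')"
  proof (rule ccontr)
    assume "\<not> ?thesis"
    then have *: "c < length g" "g ! c = g' ! c" by (auto simp: hd_drop_conv_nth)
    then have "take (Suc c) g = take (Suc c) g'"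
      using c g' assms(4) by (simp add: take_Suc_conv_app_nth)
    also have "\<dots> = initial \<omega> (Suc c)"
      using take_eq_initial_mono[OF assms(3)] * assms(4) by simp
    finally show False using confluent_length_ge[of "Suc c" g \<omega>] by (simp add: c_def)
  qed
  have "reduce (winv g @ g') = reduce ((winv (drop c g) @ winv (take c g)) @ take c g @ drop c g')"
    using c g' by (metis append_take_drop_id winv_append)
  also have "\<dots> = winv (drop c g) @ drop c g'"
    using dist assms by (simp add: reduce_simps reduce_reduced reduced_winv_append reduced_drop)
  finally show ?thesis
    using assms c g' by (simp add: free_dist_eq busemann_def c_def)
qed

lemma horoball_eq: "horoball \<omega> g = {g'. reduced g' \<and> busemann \<omega> g' \<le> busemann \<omega> g}"
  by (simp add: horoball_def)


subsection \<open>The topology of the compactification\<close>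

definition cylinder :: "(nat \<Rightarrow> 'a letter) \<Rightarrow> nat \<Rightarrow> (nat \<Rightarrow> 'a letter option) set" where
  "cylinder \<omega> n = {f \<in> topspace compactification. \<forall>i<n. f i = Some (\<omega> i)}"

lemma topspace_compactification:
  "topspace compactification = word_point ` {w. reduced w} \<union> end_point ` boundary"
  by (auto simp: compactification_def)

lemma end_point_in_cylinder: "\<omega> \<in> boundary \<Longrightarrow> end_point \<omega> \<in> cylinder \<omega> n"
  by (simp add: cylinder_def topspace_compactification end_point_def)

lemma word_point_in_cylinder_iff:
  assumes "reduced g" shows "word_point g \<in> cylinder \<omega> n \<longleftrightarrow> take n g = initial \<omega> n"
proof
  assume *: "word_point g \<in> cylinder \<omega> n"
  then have g: "i < length g \<and> g ! i = \<omega> i" if "i < n" for i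
    using that by (auto simp: cylinder_def word_point_def split: if_splits)
  then have "n \<le> length g" by (meson linorder_not_le less_irrefl)
  then show "take n g = initial \<omega> n" using g by (intro nth_equalityI) auto
next
  assume *: "take n g = initial \<omega> n"
  then have "n \<le> length g" by (rule take_eq_initial_length)
  moreover have "g ! i = \<omega> i" if "i < n" for i
    using arg_cong[OF *, of "\<lambda>w. w ! i"] that by simp
  ultimately show "word_point g \<in> cylinder \<omega> n"
    using assms by (auto simp: cylinder_def topspace_compactification word_point_def)
qed

lemma openin_cylinder: "openin compactification (cylinder \<omega> n)"
proof -
  let ?S = "\<lambda>i. if i < n then {Some (\<omega> i)} else UNIV"
  have "openin (product_topology (\<lambda>_. discrete_topology UNIV) UNIV) (PiE UNIV ?S)"
    by (intro product_topology_basis) (auto intro: finite_subset[of _ "{..<n}"])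
  moreover have "cylinder \<omega> n = PiE UNIV ?S \<inter> topspace compactification"
    by (auto simp: cylinder_def PiE_iff split: if_splits)
  ultimately show ?thesis
    unfolding compactification_def by (auto simp: openin_subtopology)
qed

lemma cylinder_subset_open:
  assumes "openin compactification U" "end_point \<omega> \<in> U"
  obtains n where "cylinder \<omega> n \<subseteq> U"
proof -
  obtain V where V: "openin (product_topology (\<lambda>_. discrete_topology UNIV) UNIV) V"
    and U: "U = V \<inter> topspace compactification"
    using assms(1) unfolding compactification_def by (auto simp: openin_subtopology)
  obtain S where S: "finite {i. S i \<noteq> UNIV}" "end_point \<omega> \<in> PiE UNIV S" "PiE UNIV S \<subseteq> V"
    using V assms(2) U unfolding openin_product_topology_alt by fastforce
  obtain n where n: "{i. S i \<noteq> UNIV} \<subseteq> {..<n}"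
    using finite_nat_iff_bounded S(1) by blast
  have "f \<in> PiE UNIV S" if "f \<in> cylinder \<omega> n" for f
  proof -
    have "f i \<in> S i" for i
      using that n S(2) by (cases "i < n") (auto simp: cylinder_def end_point_def PiE_iff)
    then show ?thesis by auto
  qed
  then have "cylinder \<omega> n \<subseteq> V" using S(3) by blast
  then have "cylinder \<omega> n \<subseteq> U" using U by (auto simp: cylinder_def)
  then show ?thesis by (rule that)
qed

lemma accumulation_end_iff:
  assumes "\<omega> \<in> boundary" "\<And>n. reduced (h n)"
  shows "accumulation_end h \<omega> \<longleftrightarrow> (\<forall>L. infinite {n. take L (h n) = initial \<omega> L})"
proof
  assume "accumulation_end h \<omega>"
  then have "infinite {n. word_point (h n) \<in> cylinder \<omega> L}" for L
    using openin_cylinder end_point_in_cylinder[OF assms(1)] by (auto simp: accumulation_end_def)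
  then show "\<forall>L. infinite {n. take L (h n) = initial \<omega> L}"
    using assms(2) by (simp add: word_point_in_cylinder_iff)
next
  assume R: "\<forall>L. infinite {n. take L (h n) = initial \<omega> L}"
  show "accumulation_end h \<omega>" unfolding accumulation_end_def
  proof (intro allI impI)
    fix U assume "openin compactification U \<and> end_point \<omega> \<in> U"
    then obtain L where "cylinder \<omega> L \<subseteq> U" using cylinder_subset_open by metis
    then have "{n. word_point (h n) \<in> cylinder \<omega> L} \<subseteq> {n. word_point (h n) \<in> U}" by blast
    then have "{n. take L (h n) = initial \<omega> L} \<subseteq> {n. word_point (h n) \<in> U}"
      using assms(2) by (simp add: word_point_in_cylinder_iff)
    then show "infinite {n. word_point (h n) \<in> U}" using R infinite_super by blast
  qed
qed

lemma limitin_end_point_iff: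
  assumes "\<omega> \<in> boundary" "\<And>n. reduced (P n)"
  shows "limitin compactification (\<lambda>n. word_point (P n)) (end_point \<omega>) sequentially
    \<longleftrightarrow> (\<forall>L. \<forall>\<^sub>F n in sequentially. take L (P n) = initial \<omega> L)" (is "?lim \<longleftrightarrow> ?R")
proof
  assume ?lim
  then have "\<forall>\<^sub>F n in sequentially. word_point (P n) \<in> cylinder \<omega> L" for L
    using openin_cylinder end_point_in_cylinder[OF assms(1)] by (auto simp: limitin_def)
  then show ?R using assms(2) by (simp add: word_point_in_cylinder_iff)
next
  assume R: ?R
  have "\<forall>\<^sub>F n in sequentially. word_point (P n) \<in> U"
    if U: "openin compactification U" "end_point \<omega> \<in> U" for U
  proof -
    obtain L where "cylinder \<omega> L \<subseteq> U" using cylinder_subset_open[OF U] .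
    moreover have "\<forall>\<^sub>F n in sequentially. word_point (P n) \<in> cylinder \<omega> L"
      using assms(2) R by (simp add: word_point_in_cylinder_iff)
    ultimately show ?thesis by (auto elim: eventually_mono)
  qed
  then show ?lim using assms(1) by (auto simp: limitin_def topspace_compactification)
qed

lemma limit_setI:
  assumes "\<omega> \<in> boundary" "H \<subseteq> {w. reduced w}"
    and "\<And>L. \<exists>h\<in>H. take L h = initial \<omega> L"
  shows "\<omega> \<in> limit_set H"
proof -
  have "\<exists>y. y \<noteq> end_point \<omega> \<and> y \<in> word_point ` H \<and> y \<in> U"
    if U: "end_point \<omega> \<in> U" "openin compactification U" for U
  proof -
    obtain L where L: "cylinder \<omega> L \<subseteq> U" using cylinder_subset_open[OF U(2,1)] .
    obtain h where h: "h \<in> H" "take L h = initial \<omega> L" using assms(3) by blast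
    then have "word_point h \<in> cylinder \<omega> L" using assms(2) by (auto simp: word_point_in_cylinder_iff)
    then have "word_point h \<in> U" using L by blast
    \<comment> \<open>A limit point needs nearby points other than itself: the padding at position
      \<open>length h\<close> tells a finite word from an infinite one.\<close>
    moreover have "word_point h (length h) \<noteq> end_point \<omega> (length h)"
      by (simp add: word_point_def end_point_def)
    ultimately show ?thesis using h(1) by (intro exI[of _ "word_point h"]) auto
  qed
  then show ?thesis
    using assms(1) by (auto simp: limit_set_def in_derived_set_of topspace_compactification)
qed


subsection \<open>Radial limit points\<close>

lemma infinite_if_unbounded_length:
  assumes "\<And>L. \<exists>w\<in>A. L \<le> length w" shows "infinite A"
proof
  assume "finite A"
  then obtain L where "\<forall>w\<in>A. length w < L"
    using finite_nat_set_iff_bounded[of "length ` A"] by auto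
  with assms[of L] show False by auto
qed

text \<open>
  For \<open>h\<close> and \<open>h'\<close> close to the ray at times \<open>k \<le> k'\<close>, with \<open>h'\<close> sharing with \<open>\<omega>\<close> more letters
  than \<open>h\<close> has, \<open>busemann \<omega> h = d(h, h') - |h'|\<close> is at most \<open>- k\<close> up to a bounded error.
\<close>

lemma (in free_subgroup) radial_subset_small_horospheric:
  "radial_limit_set H \<subseteq> small_horospheric_limit_set H"
proof
  fix \<omega> assume "\<omega> \<in> radial_limit_set H"
  then obtain \<gamma> h R where \<omega>: "\<omega> \<in> boundary" and ray: "geodesic_ray \<gamma>" and "range h \<subseteq> H"
    and near: "\<forall>n. \<exists>k. free_dist (h n) (\<gamma> k) \<le> R" and acc: "accumulation_end h \<omega>"
    unfolding radial_limit_set_def by auto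
  then have h: "h n \<in> H" "reduced (h n)" for n using reduced_mem by auto
  have \<gamma>: "reduced (\<gamma> k)" "int (free_dist (\<gamma> i) (\<gamma> j)) = \<bar>int i - int j\<bar>" for i j k
    using ray by (auto simp: geodesic_ray_def)
  obtain k where k: "free_dist (h n) (\<gamma> (k n)) \<le> R" for n using near by metis
  have k': "free_dist (\<gamma> (k n)) (h n) \<le> R" for n
    using k[of n] free_dist_commute[OF \<gamma>(1) h(2)] by simp
  \<comment> \<open>The ray need not start at the identity; \<open>C\<close> absorbs this
    offset.\<close>
  define C where "C = length (\<gamma> 0)"
  have share: "\<exists>n. take L (h n) = initial \<omega> L" for L
    using acc \<omega> h(2) by (metis (mono_tags, lifting) accumulation_end_iff empty_Collect_eq finite.emptyI)
  have len: "length (h n) \<le> C + k n + R" "k n \<le> length (h n) + C + R" for n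
  proof -
    have 1: "free_dist [] (h n) \<le> free_dist [] (\<gamma> 0) + free_dist (\<gamma> 0) (h n)"
      "free_dist (\<gamma> 0) (h n) \<le> free_dist (\<gamma> 0) (\<gamma> (k n)) + free_dist (\<gamma> (k n)) (h n)"
      "free_dist (\<gamma> 0) (\<gamma> (k n)) \<le> free_dist (\<gamma> 0) [] + free_dist [] (\<gamma> (k n))"
      "free_dist [] (\<gamma> (k n)) \<le> free_dist [] (h n) + free_dist (h n) (\<gamma> (k n))"
      using h \<gamma> by (auto intro: free_dist_triangle)
    moreover have "free_dist (\<gamma> 0) [] = C"
      "free_dist [] (\<gamma> 0) = C" "free_dist [] (h n) = length (h n)"
      using h \<gamma> by (simp_all add: free_dist_commute[of "\<gamma> 0" "[]"] free_dist_Nil C_def)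
    ultimately show "length (h n) \<le> C + k n + R" "k n \<le> length (h n) + C + R"
      using \<gamma>(2)[of 0 "k n"] k[of n] k'[of n] by linarith+
  qed
  have "\<exists>h\<in>H. L \<le> length h \<and> busemann \<omega> h \<le> N" for L N
  proof -
    \<comment> \<open>The triangle inequalities below bound \<open>busemann \<omega> (h n)\<close>
      by 2C + 4R minus the length of \<open>h n\<close>, so a length of at least \<open>M\<close>
      serves both \<open>N\<close> and \<open>L\<close>.\<close>
    define M where "M = L + nat \<bar>N\<bar> + 2 * C + 5 * R"
    obtain n where n: "take M (h n) = initial \<omega> M" using share by blast
    \<comment> \<open>The summand \<open>length (h n)\<close> makes the distance formula exact; the
      others force \<open>k n \<le> k n'\<close>, so that the ray is traversed forwards.\<close>
    define M' where "M' = length (h n) + k n + C + R"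
    obtain n' where n': "take M' (h n') = initial \<omega> M'" using share by blast
    have M: "M \<le> length (h n)" "M' \<le> length (h n')" using n n' by (auto intro: take_eq_initial_length)
    then have kk: "k n \<le> k n'" using len[of n] len[of n'] by (simp add: M'_def)
    have "int (free_dist (h n) (h n')) = busemann \<omega> (h n) + int (length (h n'))"
      using h n' by (intro free_dist_busemann[of _ _ M']) (auto simp: M'_def)
    moreover have "free_dist (h n) (h n') \<le> free_dist (h n) (\<gamma> (k n)) + free_dist (\<gamma> (k n)) (h n')"
      "free_dist (\<gamma> (k n)) (h n') \<le> free_dist (\<gamma> (k n)) (\<gamma> (k n')) + free_dist (\<gamma> (k n')) (h n')"
      using h \<gamma> by (auto intro: free_dist_triangle)
    ultimately have "busemann \<omega> (h n) \<le> N \<and> L \<le> length (h n)"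
      using k[of n] k'[of n'] kk \<gamma>(2)[of "k n" "k n'"] len[of n] len[of n'] M by (simp add: M_def)
    then show ?thesis using h by blast
  qed
  then have "infinite {h \<in> H. busemann \<omega> h \<le> N}" for N
    by (intro infinite_if_unbounded_length) blast
  moreover have "H \<inter> horoball \<omega> g = {h \<in> H. busemann \<omega> h \<le> busemann \<omega> g}" for g
    using reduced_mem by (auto simp: horoball_eq)
  ultimately show "\<omega> \<in> small_horospheric_limit_set H"
    using \<omega> by (simp add: small_horospheric_limit_set_def)
qed


subsection \<open>Counting reduced words\<close>

definition extensions :: "'a word \<Rightarrow> nat \<Rightarrow> 'a word set" where
  "extensions v n = {z. length z = n \<and> reduced (v @ z)}"

lemma finite_words_le: "finite {w :: ('a::finite) word. length w \<le> n}"
  using finite_lists_length_le[of "UNIV :: 'a letter set" n] by simp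

lemma finite_extensions: "finite (extensions (v :: ('a::finite) word) n)"
  by (rule finite_subset[OF _ finite_words_le[of n]]) (auto simp: extensions_def)

text \<open>Exactly one letter is forbidden after a given last letter. The empty word forbids none,
  hence the restriction to non-empty \<open>v\<close>.\<close>

lemma card_extensions:
  fixes v :: "('a::finite) word"
  assumes "reduced v" "v \<noteq> []"
  shows "card (extensions v n) = (2 * CARD('a) - 1) ^ n"
  using assms
proof (induction n arbitrary: v)
  case 0
  then have "extensions v 0 = {[]}" by (auto simp: extensions_def)
  then show ?case by simp
next
  case (Suc n)
  let ?A = "UNIV - {inv_letter (last v)}"
  have A: "reduced (v @ [a])" if "a \<in> ?A" for a
    using Suc.prems that by (auto simp: reduced_append reduced_Cons)
  have "extensions v (Suc n) = (\<lambda>(a, z). a # z) ` (SIGMA a:?A. extensions (v @ [a]) n)"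
  proof (intro equalityI subsetI)
    fix w assume w: "w \<in> extensions v (Suc n)"
    then obtain a z where "w = a # z" by (cases w) (auto simp: extensions_def)
    then show "w \<in> (\<lambda>(a, z). a # z) ` (SIGMA a:?A. extensions (v @ [a]) n)"
      using w Suc.prems by (force simp: extensions_def reduced_append)
  qed (auto simp: extensions_def)
  moreover have "inj_on (\<lambda>(a, z). a # z) (SIGMA a:?A. extensions (v @ [a]) n)"
    by (auto simp: inj_on_def)
  ultimately have "card (extensions v (Suc n)) = card (SIGMA a:?A. extensions (v @ [a]) n)"
    by (simp add: card_image)
  also have "\<dots> = (\<Sum>a\<in>?A. card (extensions (v @ [a]) n))"
    by (intro card_SigmaI) (auto simp: finite_extensions)
  also have "\<dots> = (\<Sum>a\<in>?A. (2 * CARD('a) - 1) ^ n)"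
    using A by (intro sum.cong Suc.IH) auto
  also have "\<dots> = card ?A * (2 * CARD('a) - 1) ^ n" by simp
  also have "card ?A = 2 * CARD('a) - 1" by (simp add: card_Diff_subset card_prod mult.commute)
  also have "(2 * CARD('a) - 1) * (2 * CARD('a) - 1) ^ n = (2 * CARD('a) - 1) ^ Suc n" by simp
  finally show ?case .
qed

lemma card_reduced_words_le:
  "card {w :: ('a::finite) word. reduced w \<and> length w = Suc n} \<le> 2 * CARD('a) * (2 * CARD('a) - 1) ^ n"
proof -
  have "{w :: 'a word. reduced w \<and> length w = Suc n} = (\<lambda>(a, z). a # z) ` (SIGMA a:UNIV. extensions [a] n)"
    by (auto simp: extensions_def length_Suc_conv image_iff)
  then have "card {w :: 'a word. reduced w \<and> length w = Suc n} \<le> card (SIGMA a:(UNIV :: 'a letter set). extensions [a] n)"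
    by (simp only:) (intro card_image_le finite_SigmaI finite_extensions, simp)
  also have "\<dots> = (\<Sum>a\<in>(UNIV :: 'a letter set). card (extensions [a] n))"
    by (intro card_SigmaI) (auto simp: finite_extensions)
  also have "\<dots> = 2 * CARD('a) * (2 * CARD('a) - 1) ^ n"
    by (simp add: card_extensions reduced_Cons card_prod)
  finally show ?thesis .
qed


subsection \<open>The Poincare series off the limit set\<close>

text \<open>
  When no element of \<open>H\<close> starts with \<open>u\<close>, the last letter of \<open>u\<close> survives in every product \<open>h u\<close>,
  so the cylinders of the words \<open>h u\<close> are the translates of the cylinder of \<open>u\<close>, and each
  point lies in boundedly many of them.
\<close>

locale avoided_cylinder = free_subgroup H for H :: "('a::finite) word set" +
  fixes u :: "'a word"
  assumes reduced_u: "reduced u"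
    and avoids: "h \<in> H \<Longrightarrow> take (length u) h \<noteq> u"
begin

text \<open>If all of \<open>u\<close> cancelled against \<open>h\<close>, the inverse of
  \<open>h\<close> would be an element of \<open>H\<close> beginning with \<open>u\<close>.\<close>

lemma translate_decomp:
  assumes "h \<in> H"
  obtains p c q where "h = p @ winv c" "u = c @ q" "q \<noteq> []" "reduce (h @ u) = p @ q"
proof -
  obtain p c q where *: "h = p @ winv c" "u = c @ q" "reduced (p @ q)"
    using cancellation[OF reduced_mem[OF assms] reduced_u] .
  have "q \<noteq> []"
    using avoids[OF winv_closed[OF assms]] * by (auto simp: winv_append)
  then show ?thesis using * by (intro that) (auto simp: reduce_simps reduce_reduced)
qed

text \<open>The quotient \<open>k\<close> of the two elements carries \<open>u\<close> to
  \<open>u @ z\<close>. What survives of \<open>k\<close> is shorter than \<open>u\<close>, since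
  otherwise \<open>k\<close> would begin with \<open>u\<close>; what cancels is the inverse of a
  prefix of \<open>u\<close>.\<close>

lemma short_quotient:
  assumes "h \<in> H" "h' \<in> H" "reduce (h' @ u) = reduce (h @ u) @ z"
  shows "length (reduce (winv h @ h')) \<le> 2 * length u"
proof -
  define k where "k = reduce (winv h @ h')"
  have k: "k \<in> H" using assms by (simp add: k_def mult_closed winv_closed)
  have "reduced (reduce (h @ u) @ z)" using assms(3) by (metis reduced_reduce)
  moreover obtain p c q where "u = c @ q" "q \<noteq> []" "reduce (h @ u) = p @ q"
    using translate_decomp[OF assms(1)] .
  \<comment> \<open>The word \<open>reduce (h @ u)\<close> ends with the last letter of
    \<open>u\<close>, so whatever may follow it may also follow \<open>u\<close>.\<close>
  ultimately have uz: "reduced (u @ z)" using reduced_u by (auto simp: reduced_append)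
  have "reduce (k @ u) = reduce (winv h @ reduce (h' @ u))"
    by (simp add: k_def reduce_simps)
  also have "\<dots> = reduce (u @ z)"
    unfolding assms(3) by (simp add: reduce_simps)
  finally have "reduce (k @ u) = u @ z" using uz by (simp add: reduce_reduced)
  moreover obtain p c q where d: "k = p @ winv c" "u = c @ q" "q \<noteq> []" "reduce (k @ u) = p @ q"
    using translate_decomp[OF k] .
  ultimately have "p @ q = u @ z" by simp
  from arg_cong[OF this, of "take (length u)"] have "take (length u) p = u" if "length u \<le> length p"
    using that by simp
  then have "length p < length u" using avoids[OF k] d(1) by (auto simp: not_le[symmetric])
  then show ?thesis using d(1,2) unfolding k_def[symmetric] by auto
qed

text \<open>Prefixes of one word are nested, so dividing by the element with the shortest translate
  embeds the family into the ball of radius \<open>2 * length u\<close>.\<close>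

lemma card_translates_le:
  assumes "finite F" "F \<subseteq> H"
  shows "card {h \<in> F. take (length (reduce (h @ u))) w = reduce (h @ u)}
    \<le> card {k :: 'a word. length k \<le> 2 * length u}" (is "card ?B \<le> card ?K")
proof (cases "?B = {}")
  case False
  then obtain h where h: "h \<in> ?B" and min: "\<And>h'. h' \<in> ?B \<Longrightarrow> length (reduce (h @ u)) \<le> length (reduce (h' @ u))"
    using ex_has_least_nat[of "\<lambda>h. h \<in> ?B" _ "\<lambda>h. length (reduce (h @ u))"] by blast
  have "reduce (winv h @ h') \<in> ?K" if h': "h' \<in> ?B" for h'
  proof -
    let ?v = "reduce (h @ u)" and ?v' = "reduce (h' @ u)"
    have "take (length ?v) ?v' = take (length ?v) (take (length ?v') w)" using h' by simp
    also have "\<dots> = ?v" using min[OF h'] h by (simp add: min_def)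
    finally have "?v' = ?v @ drop (length ?v) ?v'" by (metis append_take_drop_id)
    then show ?thesis using h h' assms(2) by (auto intro!: short_quotient)
  qed
  moreover have "inj_on (\<lambda>h'. reduce (winv h @ h')) ?B"
  proof (rule inj_onI)
    fix a b assume ab: "a \<in> ?B" "b \<in> ?B" "reduce (winv h @ a) = reduce (winv h @ b)"
    then have "reduce (h @ reduce (winv h @ a)) = reduce (h @ reduce (winv h @ b))" by simp
    then have "reduce a = reduce b" by (simp add: reduce_simps)
    then show "a = b" using ab assms(2) by (auto simp: reduce_reduced reduced_mem subset_iff)
  qed
  ultimately show ?thesis
    using finite_words_le[of "2 * length u"] by (intro card_inj_on_le[of "\<lambda>h'. reduce (winv h @ h')"]) auto
next
  case True
  then have "card ?B = 0" by (simp only: card.empty)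
  then show ?thesis by linarith
qed

text \<open>Measure is replaced by counting reduced words of one length: the number of those with a
  given non-empty prefix decays geometrically in the length of the prefix, and each word has
  boundedly many translates as prefixes.\<close>

lemma sum_translates_le:
  assumes "finite F" "F \<subseteq> H"
  shows "(\<Sum>h\<in>F. (1 / (2 * real CARD('a) - 1)) ^ length (reduce (h @ u)))
    \<le> 2 * real CARD('a) * real (card {k :: 'a word. length k \<le> 2 * length u})"
proof -
  define q where "q = 2 * CARD('a) - 1"
  define K where "K = card {k :: 'a word. length k \<le> 2 * length u}"
  have q: "2 * real CARD('a) - 1 = real q" "q \<ge> 1"
    using zero_less_card_finite[where 'a='a] unfolding q_def by linarith+
  let ?v = "\<lambda>h. reduce (h @ u)"
  obtain N where N: "\<And>h. h \<in> F \<Longrightarrow> length (?v h) \<le> N"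
    using finite_nat_set_iff_bounded_le[of "(\<lambda>h. length (?v h)) ` F"] assms(1) by auto
  define R where "R = {w :: 'a word. reduced w \<and> length w = Suc N}"
  have "finite R" by (rule finite_subset[OF _ finite_words_le[of "Suc N"]]) (auto simp: R_def)
  have card: "card {w \<in> R. take (length (?v h)) w = ?v h} = q ^ (Suc N - length (?v h))" if "h \<in> F" for h
  proof -
    obtain p c q' where "q' \<noteq> []" "?v h = p @ q'" using translate_decomp \<open>h \<in> F\<close> assms(2) by blast
    then have "card (extensions (?v h) (Suc N - length (?v h))) = q ^ (Suc N - length (?v h))"
      unfolding q_def by (intro card_extensions reduced_reduce) simp
    moreover have "{w \<in> R. take (length (?v h)) w = ?v h} = (@) (?v h) ` extensions (?v h) (Suc N - length (?v h))"
    proof (intro equalityI subsetI)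
      fix w assume w: "w \<in> {w \<in> R. take (length (?v h)) w = ?v h}"
      then have "w = ?v h @ drop (length (?v h)) w" using append_take_drop_id[of "length (?v h)" w] by simp
      then show "w \<in> (@) (?v h) ` extensions (?v h) (Suc N - length (?v h))"
        using w by (auto simp: extensions_def R_def intro!: image_eqI[of _ _ "drop (length (?v h)) w"])
    next
      fix w assume "w \<in> (@) (?v h) ` extensions (?v h) (Suc N - length (?v h))"
      then show "w \<in> {w \<in> R. take (length (?v h)) w = ?v h}"
        using N[OF that] by (auto simp: extensions_def R_def)
    qed
    ultimately show ?thesis by (simp add: card_image inj_on_def)
  qed
  have "(\<Sum>h\<in>F. q ^ (Suc N - length (?v h))) = (\<Sum>h\<in>F. card {w \<in> R. take (length (?v h)) w = ?v h})"
    using card by simp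
  also have "\<dots> = (\<Sum>w\<in>R. card {h \<in> F. take (length (?v h)) w = ?v h})"
    using \<open>finite R\<close> assms(1) by (intro sum_multicount_gen) auto
  also have "\<dots> \<le> (\<Sum>w\<in>R. K)"
    unfolding K_def by (intro sum_mono card_translates_le assms)
  also have "\<dots> = card R * K" by simp
  also have "\<dots> \<le> (2 * CARD('a) * q ^ N) * K"
    using card_reduced_words_le[where 'a='a, of N] by (intro mult_right_mono) (auto simp: R_def q_def)
  \<comment> \<open>Giving away a factor \<open>q\<close> produces the power
    \<open>q ^ Suc N\<close> that is divided out at the end.\<close>
  also have "\<dots> \<le> (2 * CARD('a) * q ^ Suc N) * K"
    using q(2) by (intro mult_right_mono mult_left_mono power_increasing) auto
  finally have *: "real (\<Sum>h\<in>F. q ^ (Suc N - length (?v h))) \<le> real ((2 * CARD('a) * q ^ Suc N) * K)"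
    by (rule of_nat_mono)
  have "real (\<Sum>h\<in>F. q ^ (Suc N - length (?v h))) = real q ^ Suc N * (\<Sum>h\<in>F. (1 / real q) ^ length (?v h))"
    unfolding sum_distrib_left of_nat_sum
  proof (intro sum.cong refl)
    fix h assume "h \<in> F"
    then show "real (q ^ (Suc N - length (?v h))) = real q ^ Suc N * (1 / real q) ^ length (?v h)"
      using N[of h] q(2) by (subst of_nat_power, subst power_diff) (auto simp: power_one_over field_simps)
  qed
  with * have "real q ^ Suc N * (\<Sum>h\<in>F. (1 / real q) ^ length (?v h))
      \<le> real q ^ Suc N * (2 * real CARD('a) * real K)"
    by (simp add: algebra_simps)
  then have "(\<Sum>h\<in>F. (1 / real q) ^ length (?v h)) \<le> 2 * real CARD('a) * real K"
    using q(2) by (subst (asm) mult_le_cancel_left_pos) auto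
  then show ?thesis by (simp add: q(1) K_def)
qed

end

lemma divergence_set_subset_limit_set:
  fixes H :: "('a::finite) word set"
  assumes "subgroup H free_group"
  shows "divergence_set H \<subseteq> limit_set H"
proof
  interpret free_subgroup H using assms by (rule free_subgroup.intro)
  define q where "q = 2 * real CARD('a) - 1"
  have q: "q \<ge> 1" using zero_less_card_finite[where 'a='a] by (simp add: q_def)
  fix \<omega> assume "\<omega> \<in> divergence_set H"
  then have \<omega>: "\<omega> \<in> boundary" and inf: "(\<Sum>\<^sub>\<infinity>h\<in>H. ennreal (q powi (- busemann \<omega> h))) = \<infinity>"
    by (auto simp: divergence_set_def q_def)
  show "\<omega> \<in> limit_set H"
  proof (rule limit_setI[OF \<omega>])
    show "H \<subseteq> {w. reduced w}" using reduced_mem by auto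
    fix L show "\<exists>h\<in>H. take L h = initial \<omega> L"
    proof (rule ccontr)
      assume none: "\<not> ?thesis"
      define u where "u = initial \<omega> L"
      interpret avoided_cylinder H u
        using none reduced_initial[OF \<omega>] by unfold_locales (auto simp: u_def)
      define K where "K = real (card {k :: 'a word. length k \<le> 2 * length u})"
      \<comment> \<open>Agreement with \<open>\<omega>\<close> stops before \<open>L\<close>, and
        multiplying by \<open>u\<close> adds at most \<open>L\<close> letters: twice the first bound
        plus the second gives the exponent \<open>3 * L\<close>.\<close>
      have le: "q powi (- busemann \<omega> h) \<le> q ^ (3 * L) * (1 / q) ^ length (reduce (h @ u))" if "h \<in> H" for h
      proof -
        have "confluent_length h \<omega> < L"
          using none that confluent_length(2)[of h \<omega>] take_eq_initial_mono[of _ h \<omega> L] by (meson not_le)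
        moreover have "length (reduce (h @ u)) \<le> length h + L"
          using length_reduce_le[of "h @ u"] by (simp add: u_def)
        ultimately have "- busemann \<omega> h \<le> int (3 * L) - int (length (reduce (h @ u)))"
          by (simp add: busemann_def)
        then have "q powi (- busemann \<omega> h) \<le> q powi (int (3 * L) - int (length (reduce (h @ u))))"
          using q by (intro power_int_increasing) auto
        also have "\<dots> = q ^ (3 * L) * (1 / q) ^ length (reduce (h @ u))"
          using q by (simp add: power_int_diff power_one_over del: of_nat_mult)
        finally show ?thesis .
      qed
      have "(\<Sum>h\<in>F. ennreal (q powi (- busemann \<omega> h))) \<le> ennreal (q ^ (3 * L) * (2 * real CARD('a) * K))"
        if F: "finite F" "F \<subseteq> H" for F
      proof -
        have "(\<Sum>h\<in>F. q powi (- busemann \<omega> h)) \<le> (\<Sum>h\<in>F. q ^ (3 * L) * (1 / q) ^ length (reduce (h @ u)))"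
          using le F by (intro sum_mono) auto
        also have "\<dots> \<le> q ^ (3 * L) * (2 * real CARD('a) * K)"
          using sum_translates_le[OF F] q unfolding sum_distrib_left[symmetric] K_def q_def[symmetric]
          by (intro mult_left_mono) auto
        finally show ?thesis using q by (simp add: sum_ennreal ennreal_leI)
      qed
      then have "(\<Sum>\<^sub>\<infinity>h\<in>H. ennreal (q powi (- busemann \<omega> h))) \<le> ennreal (q ^ (3 * L) * (2 * real CARD('a) * K))"
        by (intro infsum_le_finite_sums nonneg_summable_on_complete) auto
      with inf show False by (simp add: top_unique)
    qed
  qed
qed

lemma big_horospheric_subset_divergence_set:
  fixes H :: "('a::finite) word set"
  shows "big_horospheric_limit_set H \<subseteq> divergence_set H"
proof
  define q where "q = 2 * real CARD('a) - 1"
  have q: "q \<ge> 1" using zero_less_card_finite[where 'a='a] by (simp add: q_def)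
  fix \<omega> assume "\<omega> \<in> big_horospheric_limit_set H"
  then obtain g where \<omega>: "\<omega> \<in> boundary" and inf: "infinite (H \<inter> horoball \<omega> g)"
    by (auto simp: big_horospheric_limit_set_def)
  have "(\<Sum>\<^sub>\<infinity>h\<in>H \<inter> horoball \<omega> g. ennreal (q powi (- busemann \<omega> h))) = \<infinity>"
    using q inf
    by (intro infsum_superconst_infinite_ennreal[of _ "ennreal (q powi (- busemann \<omega> g))"])
      (auto simp: horoball_def intro!: ennreal_leI power_int_increasing)
  moreover have "(\<Sum>\<^sub>\<infinity>h\<in>H \<inter> horoball \<omega> g. ennreal (q powi (- busemann \<omega> h)))
      \<le> (\<Sum>\<^sub>\<infinity>h\<in>H. ennreal (q powi (- busemann \<omega> h)))"
    by (intro infsum_mono_neutral nonneg_summable_on_complete) auto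
  ultimately show "\<omega> \<in> divergence_set H"
    using \<omega> by (simp add: divergence_set_def q_def top_unique)
qed


subsection \<open>Cosets and walks in the spanning tree\<close>

context free_subgroup
begin

text \<open>Reducing inside makes this meaningful for arbitrary words, so moving along edges is
  plain concatenation without reducedness conditions.\<close>

definition coset :: "'a word \<Rightarrow> 'a word set" where
  "coset g = H #>\<^bsub>free_group\<^esub> reduce g"

lemma coset_letter: "coset g #>\<^bsub>free_group\<^esub> [a] = coset (g @ [a])"
  using group.coset_mult_assoc[OF group_free_group subgroup.subset[OF subgroup], of "reduce g" "[a]"]
  by (simp add: coset_def reduce_simps reduced_Cons)

lemma coset_Nil [simp]: "coset [] = H"
  using group.coset_mult_one[OF group_free_group subgroup.subset[OF subgroup]] by (simp add: coset_def)

lemma rcosets_eq: "rcosets\<^bsub>free_group\<^esub> H = range coset"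
proof
  have "H #>\<^bsub>free_group\<^esub> g \<in> range coset" if "reduced g" for g
    using that by (intro image_eqI[of _ _ g]) (simp_all add: coset_def reduce_reduced)
  then show "rcosets\<^bsub>free_group\<^esub> H \<subseteq> range coset" by (auto simp: RCOSETS_def)
  have "coset g \<in> rcosets\<^bsub>free_group\<^esub> H" for g
    unfolding RCOSETS_def coset_def by (intro UN_I[of "reduce g"]) simp_all
  then show "range coset \<subseteq> rcosets\<^bsub>free_group\<^esub> H" by blast
qed

lemma coset_append_cong:
  assumes "coset g = coset g'" shows "coset (g @ w) = coset (g' @ w)"
proof (induction w rule: rev_induct)
  case (snoc a w)
  then show ?case by (metis append_assoc coset_letter)
qed (simp add: assms)

lemma coset_reduce_eq: "reduce g = reduce g' \<Longrightarrow> coset g = coset g'"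
  by (simp add: coset_def)

lemma coset_eq_D:
  assumes "coset g = coset g'" shows "reduce (g @ winv g') \<in> H"
proof -
  have "coset (g @ winv g') = coset (g' @ winv g')" using assms by (rule coset_append_cong)
  also have "\<dots> = coset []" by (intro coset_reduce_eq) (simp add: reduce_simps)
  finally have "coset (g @ winv g') = H" by simp
  then show ?thesis
    using group.coset_join1[OF group_free_group, of H "reduce (g @ winv g')"] subgroup
    by (simp add: coset_def subgroup.subset)
qed

lemma coset_absorb:
  assumes "h \<in> H" shows "coset (h @ g) = coset g"
proof -
  have "coset h = coset []"
    unfolding coset_Nil using group.coset_join2[OF group_free_group, of h H] assms reduced_mem[OF assms] subgroup
    by (simp add: coset_def reduce_reduced)
  from coset_append_cong[OF this, of g] show ?thesis by simp
qed

primrec edges :: "'a word \<Rightarrow> 'a word \<Rightarrow> 'a edge list" where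
  "edges g [] = []"
| "edges g (a # w) = (coset g, a) # edges (g @ [a]) w"

lemma edges_append: "edges g (u @ v) = edges g u @ edges (g @ u) v"
  by (induction u arbitrary: g) auto

lemma length_edges [simp]: "length (edges g w) = length w"
  by (induction w arbitrary: g) auto

lemma map_snd_edges [simp]: "map snd (edges g w) = w"
  by (induction w arbitrary: g) auto

lemma edges_cong: "coset g = coset g' \<Longrightarrow> edges g w = edges g' w"
proof (induction w arbitrary: g g')
  case (Cons a w)
  from Cons.IH[OF coset_append_cong[OF Cons.prems, of "[a]"]] Cons.prems show ?case by simp
qed simp

lemma edges_nth: "i < length w \<Longrightarrow> edges g w ! i = (coset (g @ take i w), w ! i)"
  by (induction w arbitrary: g i) (auto simp: nth_Cons split: nat.splits)

lemma awalk_iff_edges: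
  assumes "wf_digraph G" "verts G = rcosets\<^bsub>free_group\<^esub> H"
    and "tail G = fst" "head G = (\<lambda>(x, a). x #>\<^bsub>free_group\<^esub> [a])"
  shows "pre_digraph.awalk G (coset g) p y
    \<longleftrightarrow> p = edges g (map snd p) \<and> set p \<subseteq> arcs G \<and> y = coset (g @ map snd p)"
proof (induction p arbitrary: g)
  case Nil
  show ?case using wf_digraph.awalk_Nil_iff[OF assms(1)] assms(2) rcosets_eq by auto
next
  case (Cons e p)
  obtain x a where e: "e = (x, a)" by (cases e)
  show ?case
  proof (cases "x = coset g")
    case True
    then show ?thesis
      using wf_digraph.awalk_Cons_iff[OF assms(1), of "coset g" e p y] Cons[of "g @ [a]"] assms(3,4)
      by (auto simp: e coset_letter)
  next
    case False
    then show ?thesis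
      using wf_digraph.awalk_Cons_iff[OF assms(1), of "coset g" e p y] assms(3) by (auto simp: e)
  qed
qed

end

section \<open>Reduced walks in the spanning tree, the Schreier transversal and its
  generators\<close>

locale schreier_tree = free_subgroup H for H :: "'a word set" +
  fixes T :: "'a schreier"
  assumes geodesic: "geodesic_spanning_tree H T"
begin

lemma tree_simps:
  "verts T = rcosets\<^bsub>free_group\<^esub> H" "tail T = fst" "head T = (\<lambda>(x, a). x #>\<^bsub>free_group\<^esub> [a])"
  and tree_wf: "wf_digraph T"
  using geodesic
  by (auto simp: geodesic_spanning_tree_def spanning_subtree_def spanning_def subgraph_def
      compatible_def schreier_graph_def)

lemma tree_rev:
  assumes "(coset g, a) \<in> arcs T" shows "(coset (g @ [a]), inv_letter a) \<in> arcs T"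
proof -
  have "edge_rev (coset g, a) \<in> arcs T"
    using geodesic assms unfolding geodesic_spanning_tree_def spanning_subtree_def by blast
  then show ?thesis by (simp add: edge_rev_def coset_letter)
qed

lemma tree_cycle: "pre_digraph.cycle T p \<Longrightarrow> \<exists>e. p = [e, edge_rev e]"
  using geodesic unfolding geodesic_spanning_tree_def spanning_subtree_def by blast

lemma tree_rev_iff: "(coset (g @ [a]), inv_letter a) \<in> arcs T \<longleftrightarrow> (coset g, a) \<in> arcs T"
proof
  assume "(coset (g @ [a]), inv_letter a) \<in> arcs T"
  from tree_rev[OF this] have "(coset (g @ [a] @ winv [a]), a) \<in> arcs T"
    by (simp add: winv_Cons)
  moreover have "coset (g @ [a] @ winv [a]) = coset g"
    by (intro coset_reduce_eq) (simp only: reduce_simps)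
  ultimately show "(coset g, a) \<in> arcs T" by simp
qed (rule tree_rev)

definition twalk :: "'a word \<Rightarrow> 'a word \<Rightarrow> bool" where
  "twalk g w \<longleftrightarrow> set (edges g w) \<subseteq> arcs T"

lemma twalk_Nil [simp]: "twalk g []"
  and twalk_Cons: "twalk g (a # w) \<longleftrightarrow> (coset g, a) \<in> arcs T \<and> twalk (g @ [a]) w"
  and twalk_append: "twalk g (u @ v) \<longleftrightarrow> twalk g u \<and> twalk (g @ u) v"
  by (auto simp: twalk_def edges_append)

lemma twalk_cong: "coset g = coset g' \<Longrightarrow> twalk g w = twalk g' w"
  by (simp add: twalk_def edges_cong[of g g'])

lemma awalk_tree_iff:
  "pre_digraph.awalk T (coset g) p y
    \<longleftrightarrow> p = edges g (map snd p) \<and> twalk g (map snd p) \<and> y = coset (g @ map snd p)"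
  by (subst awalk_iff_edges[OF tree_wf tree_simps]) (auto simp: twalk_def)

lemma twalk_winv: "twalk g w \<Longrightarrow> twalk (g @ w) (winv w)"
proof (induction w arbitrary: g)
  case (Cons a w)
  then have a: "(coset g, a) \<in> arcs T" and "twalk (g @ [a] @ w) (winv w)"
    using Cons.IH[of "g @ [a]"] by (auto simp: twalk_Cons)
  moreover have "coset ((g @ [a]) @ w @ winv w) = coset (g @ [a])"
    by (intro coset_reduce_eq) (simp only: reduce_simps)
  ultimately show ?case by (simp add: winv_Cons twalk_append twalk_Cons tree_rev)
qed simp

lemma twalk_reduce: "twalk g w \<Longrightarrow> twalk g (reduce w)"
proof (induction w arbitrary: g)
  case (Cons a w)
  then have "twalk g (a # reduce w)" by (auto simp: twalk_Cons)
  moreover have "twalk g (push a v)" if "twalk g (a # v)" for v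
  proof (cases "v \<noteq> [] \<and> hd v = inv_letter a")
    case True
    then obtain v' where v: "v = inv_letter a # v'" by (cases v) auto
    have "coset (g @ [a] @ winv [a]) = coset g"
      by (intro coset_reduce_eq) (simp only: reduce_simps)
    from twalk_cong[OF this] show ?thesis using that by (simp add: v twalk_Cons winv_Cons)
  next
    case False
    then show ?thesis using that by (cases v) auto
  qed
  ultimately show ?case by (simp add: reduce_def)
qed simp

text \<open>A non-empty closed walk without repeated heads is a cycle, hence a backtracking along
  one edge, and its label is not reduced. Otherwise a shorter closed walk sits between two equal
  heads.\<close>

lemma closed_twalk_eq_Nil:
  assumes "twalk g w" "reduced w" "coset (g @ w) = coset g"
  shows "w = []"
  using assms
proof (induction "length w" arbitrary: g w rule: less_induct)
  case less
  interpret T: wf_digraph T by (rule tree_wf)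
  let ?p = "edges g w"
  have head: "map (head T) ?p ! i = coset (g @ take (Suc i) w)" if "i < length w" for i
    using that by (simp add: edges_nth tree_simps coset_letter take_Suc_conv_app_nth)
  show "w = []"
  proof (rule ccontr)
    assume ne: "w \<noteq> []"
    show False
    proof (cases "distinct (map (head T) ?p)")
      case True
      have walk: "T.awalk (coset g) ?p (coset g)" using less.prems by (simp add: awalk_tree_iff)
      have "?p \<noteq> []" using ne by (metis length_0_conv length_edges)
      then have "T.cycle ?p"
        using walk True unfolding T.cycle_def T.awalk_def by (auto simp: T.awalk_verts_conv')
      then obtain e where "?p = [e, edge_rev e]" using tree_cycle by blast
      then have "w = [snd e, inv_letter (snd e)]"
        using map_snd_edges[of g w] by (auto simp: edge_rev_def split: prod.splits)
      then show False using less.prems(2) by (simp add: reduced_Cons)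
    next
      case False
      then obtain i j where "i < length w" "j < length w" "i \<noteq> j"
        "map (head T) ?p ! i = map (head T) ?p ! j"
        by (auto simp: distinct_conv_nth)
      then obtain i j where ij: "i < j" "j < length w" "map (head T) ?p ! i = map (head T) ?p ! j"
        by (metis nat_neq_iff)
      \<comment> \<open>This omits at least the first letter, so the induction hypothesis applies,
        and it is non-empty because \<open>i < j\<close>.\<close>
      define v where "v = drop (Suc i) (take (Suc j) w)"
      have v: "take (Suc i) w @ v = take (Suc j) w"
        using append_take_drop_id[of "Suc i" "take (Suc j) w"] ij by (simp add: v_def min_def)
      have w: "take (Suc i) w @ v @ drop (Suc j) w = w"
        using append_take_drop_id[of "Suc j" w] v by (metis append_assoc)
      have "v = []"
      proof (rule less.hyps)
        show "length v < length w" using ij by (simp add: v_def)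
        have "twalk g (take (Suc i) w @ v @ drop (Suc j) w)" "reduced (take (Suc i) w @ v @ drop (Suc j) w)"
          using less.prems(1,2) w by simp_all
        then show "twalk (g @ take (Suc i) w) v" "reduced v"
          by (simp_all only: twalk_append reduced_append)
        show "coset ((g @ take (Suc i) w) @ v) = coset (g @ take (Suc i) w)"
          using head ij v by simp
      qed
      then show False using ij by (simp add: v_def)
    qed
  qed
qed

text \<open>Going back along \<open>u\<close> and then along \<open>v\<close> is a closed walk in
  the tree, and it stays one after reduction.\<close>

lemma twalk_unique:
  assumes "twalk g u" "twalk g v" "reduced u" "reduced v" "coset (g @ u) = coset (g @ v)"
  shows "u = v"
proof -
  have ret: "coset ((g @ u) @ winv u) = coset g"
    by (intro coset_reduce_eq) (simp add: reduce_simps)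
  have "twalk (g @ u) (winv u @ v)"
    unfolding twalk_append twalk_cong[OF ret] using twalk_winv[OF assms(1)] assms(2) by blast
  then have "twalk (g @ u) (reduce (winv u @ v))" by (rule twalk_reduce)
  moreover have "coset ((g @ u) @ reduce (winv u @ v)) = coset (g @ v)"
    by (intro coset_reduce_eq)
      (simp only: reduce_append_right, simp only: append_assoc reduce_cancel_right)
  ultimately have "reduce (winv u @ v) = []"
    unfolding assms(5)[symmetric] by (intro closed_twalk_eq_Nil reduced_reduce)
  then show ?thesis using assms(3,4) by (rule reduce_winv_append_eq_Nil)
qed

lemma apath_tree:
  assumes "pre_digraph.apath T (coset g) p y"
  shows "p = edges g (map snd p)" "twalk g (map snd p)" "y = coset (g @ map snd p)" "reduced (map snd p)"
proof -
  interpret T: wf_digraph T by (rule tree_wf)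
  show "p = edges g (map snd p)" "twalk g (map snd p)" "y = coset (g @ map snd p)"
    using assms T.awalkI_apath awalk_tree_iff by blast+
  show "reduced (map snd p)" using assms
  proof (induction p arbitrary: g)
    case (Cons e p)
    then have e: "e = (coset g, snd e)" "T.apath (coset (g @ [snd e])) p y"
      "coset g \<notin> set (T.awalk_verts (head T e) p)"
      by (auto simp: T.apath_Cons_iff tree_simps coset_letter split: prod.splits)
    have "snd f \<noteq> inv_letter (snd e)" if p: "p = f # p'" for f p'
    proof
      assume f: "snd f = inv_letter (snd e)"
      have "head T f = coset (g @ [snd e] @ winv [snd e])"
        using e(2) f by (auto simp: p T.apath_Cons_iff tree_simps coset_letter winv_Cons split: prod.splits)
      also have "\<dots> = coset g" by (intro coset_reduce_eq) (simp only: reduce_simps)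
      finally have "head T f = coset g" .
      moreover have "T.apath (head T f) p' y" using e(2) by (simp add: p T.apath_Cons_iff)
      ultimately show False using e(3) T.hd_in_awalk_verts(2) by (auto simp: p)
    qed
    then show ?case using Cons.IH[OF e(2)] by (cases p) (auto simp: reduced_Cons)
  qed simp
qed

lemma apath_ex: "\<exists>p. pre_digraph.apath T (coset g) p (coset g')"
proof -
  interpret T: wf_digraph T by (rule tree_wf)
  have "coset g \<rightarrow>\<^sup>*\<^bsub>T\<^esub> coset g'"
    using geodesic tree_simps(1) rcosets_eq
    by (simp add: geodesic_spanning_tree_def spanning_subtree_def strongly_connected_def)
  then show ?thesis by (simp add: T.reachable_apath)
qed

lemma tree_path_eq:
  assumes "twalk g w" "reduced w"
  shows "tree_path T (coset g) (coset (g @ w)) = edges g w"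
proof -
  have eq: "p = edges g w" if p: "pre_digraph.apath T (coset g) p (coset (g @ w))" for p
  proof -
    have "w = map snd p"
      using assms(1) apath_tree(2)[OF p] assms(2) apath_tree(4,3)[OF p] by (rule twalk_unique)
    then show ?thesis using apath_tree(1)[OF p] by (simp only:)
  qed
  obtain p where "pre_digraph.apath T (coset g) p (coset (g @ w))" using apath_ex by blast
  with eq have "pre_digraph.apath T (coset g) (edges g w) (coset (g @ w))" by blast
  then show ?thesis unfolding tree_path_def using eq by (rule the_equality)
qed

text \<open>The \<open>t g\<close> of the overview: the representative of the coset of
  \<open>g\<close> in the Schreier transversal cut out by the tree.\<close>

definition tau :: "'a word \<Rightarrow> 'a word" where
  "tau g = map snd (tree_path T H (coset g))"

lemma tau:
  shows reduced_tau [simp]: "reduced (tau g)"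
    and twalk_tau: "twalk [] (tau g)"
    and coset_tau [simp]: "coset (tau g) = coset g"
proof -
  obtain p where "pre_digraph.apath T (coset []) p (coset g)" using apath_ex by blast
  note p = apath_tree[OF this]
  have "tree_path T H (coset g) = p"
    using tree_path_eq[OF p(2,4)] p(1,3)[symmetric] by simp
  then show "reduced (tau g)" "twalk [] (tau g)" "coset (tau g) = coset g"
    using p(2-4) by (simp_all add: tau_def)
qed

lemma tau_cong: "coset g = coset g' \<Longrightarrow> tau g = tau g'"
  by (simp add: tau_def)

lemma tau_eqI:
  assumes "twalk [] w" "reduced w" "coset w = coset g" shows "tau g = w"
  using twalk_unique[of "[]" "tau g" w] assms by (simp add: twalk_tau)

lemma tau_Nil [simp]: "tau [] = []"
  by (intro tau_eqI) auto

text \<open>The edge may lead back towards the base point, in which case \<open>a\<close> cancels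
  the last letter of \<open>tau g\<close>; hence the \<open>reduce\<close>.\<close>

lemma tau_edge:
  assumes "(coset g, a) \<in> arcs T" shows "tau (g @ [a]) = reduce (tau g @ [a])"
proof (intro tau_eqI twalk_reduce reduced_reduce)
  show "twalk [] (tau g @ [a])" using assms by (simp add: twalk_append twalk_tau twalk_Cons)
  have "coset (reduce (tau g @ [a])) = coset (tau g @ [a])"
    by (intro coset_reduce_eq) (simp add: reduce_reduced)
  then show "coset (reduce (tau g @ [a])) = coset (g @ [a])"
    using coset_append_cong[OF coset_tau] by simp
qed

text \<open>The word \<open>g\<close> labels a path in the Schreier graph to the same vertex, and
  the tree distance to this vertex equals the graph distance.\<close>

lemma length_tau_le: "length (tau g) \<le> length g"
proof -
  let ?X = "schreier_graph H" and ?x = "coset g"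
  have X: "wf_digraph ?X" "verts ?X = rcosets\<^bsub>free_group\<^esub> H" "tail ?X = fst"
    "head ?X = (\<lambda>(x, a). x #>\<^bsub>free_group\<^esub> [a])" "arcs ?X = (rcosets\<^bsub>free_group\<^esub> H) \<times> UNIV"
    using wf_digraph_schreier_graph[OF subgroup] by (auto simp: schreier_graph_def)
  have "set (edges u w) \<subseteq> arcs ?X" for u w
    by (induction w arbitrary: u) (auto simp: X(5) rcosets_eq)
  then have "pre_digraph.awalk ?X (coset []) (edges [] g) ?x"
    by (subst awalk_iff_edges[OF X(1-4)]) simp
  then have "graph_dist ?X H ?x \<le> length g"
    unfolding graph_dist_def by (intro Least_le exI[of _ "edges [] g"]) simp
  moreover have "graph_dist T H ?x = graph_dist ?X H ?x"
    using geodesic by (simp add: geodesic_spanning_tree_def X(2) rcosets_eq)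
  moreover have "length (tau g) \<le> graph_dist T H ?x"
  proof -
    have "pre_digraph.awalk T (coset []) (edges [] (tau g)) ?x"
      by (subst awalk_tree_iff) (simp add: twalk_tau)
    \<comment> \<open>The least length is attained by some walk in the tree; reducing it yields
      \<open>tau g\<close> and cannot lengthen it.\<close>
    then have "\<exists>n p. pre_digraph.awalk T H p ?x \<and> length p = n" by auto
    from LeastI_ex[OF this] obtain p where
      p: "pre_digraph.awalk T (coset []) p ?x" "length p = graph_dist T H ?x"
      unfolding graph_dist_def by auto
    from p(1) have "twalk [] (map snd p)" "?x = coset ([] @ map snd p)"
      unfolding awalk_tree_iff by blast+
    then have "twalk [] (reduce (map snd p))" "coset (map snd p) = ?x"
      by (simp_all add: twalk_reduce)
    moreover have "coset (reduce (map snd p)) = coset (map snd p)"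
      by (intro coset_reduce_eq) (simp add: reduce_reduced)
    ultimately have "tau g = reduce (map snd p)" by (intro tau_eqI) auto
    then show ?thesis using p(2) length_reduce_le[of "map snd p"] by simp
  qed
  ultimately show ?thesis by simp
qed

lemma schreier_generator_eq:
  "schreier_generator H T (coset g, a) = reduce (tau g @ [a] @ winv (tau (g @ [a])))"
proof -
  have "map snd (tree_path T (coset g') H) = winv (tau g')" for g'
  proof -
    have ret: "coset (g' @ winv (tau g')) = coset (tau g' @ winv (tau g'))"
      by (intro coset_append_cong) simp
    also have "\<dots> = coset []" by (intro coset_reduce_eq) (simp add: reduce_simps)
    finally have "coset (g' @ winv (tau g')) = H" by simp
    moreover have "twalk g' (winv (tau g'))"
      using twalk_winv[OF twalk_tau, of g'] twalk_cong[OF coset_tau, of g'] by simp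
    ultimately show ?thesis
      using tree_path_eq[of g' "winv (tau g')"] by (simp add: reduced_winv)
  qed
  then show ?thesis
    by (simp add: schreier_generator_def schreier_graph_def coset_letter tau_def)
qed

lemma schreier_generators_iff:
  "s \<in> schreier_generators H T
    \<longleftrightarrow> (\<exists>g a. (coset g, a) \<notin> arcs T \<and> s = reduce (tau g @ [a] @ winv (tau (g @ [a]))))"
proof -
  have "arcs (schreier_graph H) - arcs T = {(coset g, a) |g a. (coset g, a) \<notin> arcs T}"
    by (auto simp: schreier_graph_def rcosets_eq)
  then have "schreier_generators H T = {schreier_generator H T (coset g, a) |g a. (coset g, a) \<notin> arcs T}"
    unfolding schreier_generators_def by (simp only:) blast
  then show ?thesis by (simp only: schreier_generator_eq mem_Collect_eq) blast
qed

lemma generator_closed: "reduce (tau g @ [a] @ winv (tau (g @ [a]))) \<in> H"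
  using coset_eq_D[of "tau g @ [a]" "tau (g @ [a])"] coset_append_cong[of "tau g" g "[a]"] by simp

text \<open>Cancellation of \<open>a\<close> would make its edge the reversal of the last tree edge,
  and the tree is closed under reversal.\<close>

lemma reduced_leave:
  assumes "twalk g w" "reduced w" "(coset (g @ w), a) \<notin> arcs T"
  shows "reduced (w @ [a])"
proof (cases w rule: rev_cases)
  case (snoc w' b)
  then have "(coset ((g @ w') @ [b]), inv_letter b) \<in> arcs T"
    using assms(1) by (intro tree_rev) (simp add: twalk_append twalk_Cons)
  then show ?thesis using assms snoc by (auto simp: reduced_append reduced_Cons)
qed (simp add: reduced_Cons)

lemma reduced_enter:
  assumes "(coset g, a) \<notin> arcs T" "twalk (g @ [a]) w" "reduced w"
  shows "reduced (a # w)"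
  using assms by (cases w) (auto simp: twalk_Cons reduced_Cons tree_rev_iff)

lemma reduced_Cons_winv_tau:
  assumes "(coset g, a) \<notin> arcs T" shows "reduced (a # winv (tau (g @ [a])))"
  using assms
proof (rule reduced_enter)
  have "twalk (tau (g @ [a])) (winv (tau (g @ [a])))" using twalk_winv[OF twalk_tau] by simp
  then show "twalk (g @ [a]) (winv (tau (g @ [a])))" by (rule twalk_cong[OF coset_tau, THEN iffD1])
qed (simp add: reduced_winv)

end


context schreier_tree
begin

subsection \<open>Small horospheric limit points are Schreier limit points\<close>

text \<open>The element of \<open>H\<close> that reads \<open>g\<close> and then returns to the base point inside the tree.\<close>

definition loop_word :: "'a word \<Rightarrow> 'a word" where
  "loop_word g = reduce (g @ winv (tau g))"

lemma loop_word_Nil [simp]: "loop_word [] = []"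
  by (simp add: loop_word_def)

lemma loop_word_closed: "loop_word g \<in> H"
  using coset_eq_D[of g "tau g"] by (simp add: loop_word_def)

lemma loop_word_tau: "reduce (loop_word g @ tau g) = reduce g"
  unfolding loop_word_def by (simp only: reduce_append_left append_assoc) (simp add: reduce_simps)

text \<open>Inserting \<open>tau g\<close> and its inverse splits off the generator of the edge just
  traversed; this is the Schreier rewriting step.\<close>

lemma loop_word_snoc:
  "loop_word (g @ [a]) = reduce (loop_word g @ reduce (tau g @ [a] @ winv (tau (g @ [a]))))"
  unfolding loop_word_def
  by (simp only: reduce_append_left reduce_append_right append_assoc) (simp add: reduce_simps)

lemma loop_word_snoc_tree:
  assumes "(coset g, a) \<in> arcs T" shows "loop_word (g @ [a]) = loop_word g"
proof -
  have "loop_word (g @ [a]) = reduce ((g @ [a]) @ winv (tau g @ [a]))"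
    unfolding loop_word_def tau_edge[OF assms] winv_reduce by (simp only: reduce_append_right)
  also have "\<dots> = reduce (g @ [a] @ winv [a] @ winv (tau g))" by (simp add: winv_append)
  also have "\<dots> = loop_word g" by (simp only: reduce_cancel_right loop_word_def)
  finally show ?thesis .
qed

context
  fixes \<omega> :: "nat \<Rightarrow> 'a letter"
  assumes \<omega>: "\<omega> \<in> boundary"
begin

definition crossings :: "nat set" where
  "crossings = {k. (coset (initial \<omega> k), \<omega> k) \<notin> arcs T}"

lemma loop_word_constant:
  assumes "i \<le> j" "\<And>k. i \<le> k \<Longrightarrow> k < j \<Longrightarrow> k \<notin> crossings"
  shows "loop_word (initial \<omega> j) = loop_word (initial \<omega> i)"
  using assms
proof (induction j rule: dec_induct)
  case (step j)
  then have "(coset (initial \<omega> j), \<omega> j) \<in> arcs T" by (simp add: crossings_def)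
  from loop_word_snoc_tree[OF this] step show ?case by simp
qed simp

text \<open>
  Beyond the last crossing the vertex of \<open>\<omega>\<close> at time \<open>n\<close> has depth at least \<open>n\<close> up to a
  constant, which bounds the Busemann function on \<open>H\<close> from below.
\<close>

lemma infinite_crossings:
  assumes "\<omega> \<in> small_horospheric_limit_set H" shows "infinite crossings"
proof
  assume "finite crossings"
  then obtain n where n: "\<And>k. k \<in> crossings \<Longrightarrow> k < n"
    using finite_nat_iff_bounded by auto
  define h where "h = loop_word (initial \<omega> n)"
  have low: "- int (length h) \<le> busemann \<omega> h'" if h': "h' \<in> H" for h'
  proof -
    \<comment> \<open>Late enough to be past all crossings, and at least the length of
      \<open>h'\<close>, as the distance formula requires.\<close>
    define k where "k = n + length h'"
    let ?g = "initial \<omega> k"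
    have red: "reduced ?g" using \<omega> by (rule reduced_initial)
    have "loop_word ?g = h"
      unfolding h_def using n by (intro loop_word_constant) (fastforce simp: k_def)+
    then have "?g = reduce (h @ tau ?g)"
      using loop_word_tau[of ?g] reduce_reduced[OF red] by simp
    then have "length ?g \<le> length (h @ tau ?g)" using length_reduce_le by metis
    then have "k \<le> length h + length (tau ?g)" by simp
    \<comment> \<open>Left multiplication by an element of \<open>H\<close> preserves the coset, so
      one depth bounds the distances from \<open>?g\<close> to all points of
      \<open>H\<close>.\<close>
    moreover have "length (tau ?g) = length (tau (reduce (winv h' @ ?g)))"
      using coset_absorb[OF winv_closed[OF h'], of ?g]
      by (intro arg_cong[of _ _ length] tau_cong) (simp add: coset_def reduce_reduced)
    moreover have "int (length (reduce (winv h' @ ?g))) = busemann \<omega> h' + int k"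
      using free_dist_busemann[of h' ?g k \<omega>] red reduced_mem[OF h']
      by (simp add: free_dist_eq k_def)
    ultimately show ?thesis using length_tau_le[of "reduce (winv h' @ ?g)"] by linarith
  qed
  have "H \<inter> horoball \<omega> (initial \<omega> (Suc (length h))) = {}"
    using low by (fastforce simp: horoball_eq simp del: upt_Suc)
  moreover have "infinite (H \<inter> horoball \<omega> (initial \<omega> (Suc (length h))))"
    using assms reduced_initial[OF \<omega>] by (simp add: small_horospheric_limit_set_def del: upt_Suc)
  ultimately show False by simp
qed

text \<open>The generators of the successive crossings serve as letters. Tree edges leave
  \<open>loop_word\<close> unchanged, so its values at the crossings are the partial products; each
  begins with \<open>\<omega>\<close> up to its last crossing, since nothing cancels behind an edge
  outside the tree.\<close>

lemma schreier_limit_point: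
  assumes inf: "infinite crossings" shows "\<omega> \<in> schreier_limit_set H T"
proof -
  define e where "e = enumerate crossings"
  define s where "s n = reduce (tau (initial \<omega> (e n)) @ [\<omega> (e n)] @ winv (tau (initial \<omega> (Suc (e n)))))" for n
  have e: "(coset (initial \<omega> (e n)), \<omega> (e n)) \<notin> arcs T" for n
    using enumerate_in_set[OF inf, of n] by (simp add: e_def crossings_def)
  have snoc: "initial \<omega> (Suc k) = initial \<omega> k @ [\<omega> k]" for k by simp
  have gen: "s n \<in> schreier_generators H T" for n
    unfolding schreier_generators_iff s_def snoc using e by blast
  have cross: "loop_word (initial \<omega> (Suc (e n))) = reduce (loop_word (initial \<omega> (e n)) @ s n)" for n
    unfolding s_def snoc by (rule loop_word_snoc)
  have prod: "partial_product s n = loop_word (initial \<omega> (e n))" for n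
  proof (induction n)
    case 0
    have "k \<notin> crossings" if "k < e 0" for k
      using that not_less_Least unfolding e_def enumerate_0 by blast
    then show ?case using loop_word_constant[of 0 "e 0"] by simp
  next
    case (Suc n)
    have "k \<notin> crossings" if "Suc (e n) \<le> k" "k < e (Suc n)" for k
      using that not_less_Least[of k "\<lambda>k. k \<in> crossings \<and> e n < k"]
      unfolding e_def enumerate_Suc''[OF inf] by auto
    moreover have "Suc (e n) \<le> e (Suc n)" using enumerate_step[OF inf, of n] by (simp add: e_def)
    ultimately have "loop_word (initial \<omega> (e (Suc n))) = loop_word (initial \<omega> (Suc (e n)))"
      by (intro loop_word_constant)
    then show ?case using cross[of n] Suc by simp
  qed
  have tail: "reduced (\<omega> (e n) # winv (tau (initial \<omega> (Suc (e n)))))" for n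
    using reduced_Cons_winv_tau[OF e] unfolding snoc .
  have red: "reduced (initial \<omega> (Suc (e n)) @ winv (tau (initial \<omega> (Suc (e n)))))" for n
    using tail[of n] reduced_initial[OF \<omega>, of "Suc (e n)"]
    by (auto simp: reduced_append reduced_Cons)
  \<comment> \<open>The product is \<open>loop_word\<close> just after crossing number
    \<open>n - 1\<close>, counted from 0. As \<open>enumerate\<close> is at least its index, this
    crossing is at or beyond position \<open>L\<close>.\<close>
  have "take L (partial_product s n) = initial \<omega> L" if n: "Suc L \<le> n" for n L
  proof -
    obtain m where m: "n = Suc m" using n by (cases n) auto
    have "L \<le> Suc (e m)" using le_enumerate[OF inf, of m] n by (simp add: e_def m)
    have "partial_product s n = loop_word (initial \<omega> (Suc (e m)))"
      unfolding m using prod[of m] cross[of m] by simp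
    also have "\<dots> = initial \<omega> (Suc (e m)) @ winv (tau (initial \<omega> (Suc (e m))))"
      unfolding loop_word_def by (rule reduce_reduced[OF red])
    finally have "take L (partial_product s n) = take L (initial \<omega> (Suc (e m)))"
      using \<open>L \<le> Suc (e m)\<close> by (simp del: upt_Suc)
    then show ?thesis using take_initial[OF \<open>L \<le> Suc (e m)\<close>] by simp
  qed
  then have "\<forall>L. \<forall>\<^sub>F n in sequentially. take L (partial_product s n) = initial \<omega> L"
    by (meson eventually_sequentiallyI)
  moreover have "reduced (partial_product s n)" for n
    by (cases n) simp_all
  ultimately have lim: "limitin compactification (\<lambda>n. word_point (partial_product s n)) (end_point \<omega>) sequentially"
    using limitin_end_point_iff[OF \<omega>] by blast
  have "s (Suc n) \<noteq> inv\<^bsub>free_group\<^esub> (s n)" for n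
  proof
    assume inv: "s (Suc n) = inv\<^bsub>free_group\<^esub> (s n)"
    let ?i = "e n" and ?j = "e (Suc n)"
    \<comment> \<open>If the generators cancelled, \<open>loop_word\<close> would take the same
      value before the first crossing and after the second, making the product of \<open>?u\<close>,
      \<open>w\<close> and \<open>?v\<close> trivial; but their concatenation is reduced and
      non-empty.\<close>
    define w where "w = map \<omega> [?i..<Suc ?j]"
    have ij: "?i < ?j" using enumerate_step[OF inf, of n] by (simp add: e_def)
    have w: "initial \<omega> ?i @ w = initial \<omega> (Suc ?j)" "w \<noteq> []" "hd w = \<omega> ?i" "last w = \<omega> ?j"
      using ij upt_add_eq_append[of 0 ?i "Suc ?j - ?i"]
      by (simp_all add: w_def hd_map last_map flip: map_append del: upt_Suc)
    have rw: "reduced w"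
      using reduced_initial[OF \<omega>, of "Suc ?j"] unfolding w(1)[symmetric] reduced_append by blast
    let ?u = "tau (initial \<omega> ?i)" and ?v = "winv (tau (initial \<omega> (Suc ?j)))"
    have "reduced (?u @ [\<omega> ?i])" by (rule reduced_leave[of "[]"]) (simp_all add: twalk_tau e)
    then have "reduced (?u @ w)"
      using rw w by (auto simp: reduced_append)
    moreover have "reduced (w @ ?v)"
      using tail[of "Suc n"] rw w by (auto simp: reduced_append reduced_Cons)
    ultimately have r: "reduced (?u @ w @ ?v)"
      using w(2) by (auto simp: reduced_append)
    have j: "loop_word (initial \<omega> ?j) = reduce (loop_word (initial \<omega> ?i) @ s n)"
      using prod[of "Suc n"] prod[of n] by simp
    have "reduce (s n @ s (Suc n)) = []"
      unfolding inv using inv_free_group_winv[of "s n"] by (simp add: s_def reduce_winv_right)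
    moreover have "loop_word (initial \<omega> (Suc ?j)) = reduce (loop_word (initial \<omega> ?i) @ s n @ s (Suc n))"
      using cross[of "Suc n"] unfolding j by (simp only: reduce_append_left append_assoc)
    moreover have "\<dots> = reduce (loop_word (initial \<omega> ?i) @ reduce (s n @ s (Suc n)))"
      by (simp only: reduce_append_right)
    ultimately have "loop_word (initial \<omega> (Suc ?j)) = loop_word (initial \<omega> ?i)"
      using reduced_mem[OF loop_word_closed] by (simp add: reduce_reduced)
    then have eq: "reduce (initial \<omega> ?i @ w @ ?v) = reduce (initial \<omega> ?i @ winv ?u)"
      unfolding loop_word_def w(1)[symmetric] by simp
    have "reduce (?u @ w @ ?v) = reduce ((?u @ winv (initial \<omega> ?i)) @ reduce (initial \<omega> ?i @ w @ ?v))"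
      unfolding reduce_append_right by (simp only: append_assoc reduce_cancel_left)
    also have "\<dots> = []"
      unfolding eq reduce_append_right by (simp only: append_assoc reduce_cancel_left reduce_winv_right)
    finally show False using reduce_reduced[OF r] w(2) by simp
  qed
  then show ?thesis using \<omega> gen lim by (auto simp: schreier_limit_set_def)
qed

end

lemma small_horospheric_subset_schreier:
  "small_horospheric_limit_set H \<subseteq> schreier_limit_set H T"
proof
  fix \<omega> assume *: "\<omega> \<in> small_horospheric_limit_set H"
  then have "\<omega> \<in> boundary" by (simp add: small_horospheric_limit_set_def)
  then show "\<omega> \<in> schreier_limit_set H T"
    using * by (intro schreier_limit_point infinite_crossings)
qed


subsection \<open>Schreier limit points are big horospheric limit points\<close>

text \<open>
  The product of the first \<open>n + 1\<close> generators is the reduced word \<open>front n\<close>, which ends with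
  the letter of the last edge outside the tree, followed by a tree path back to the base point. This
  path is geodesic, hence no longer than \<open>front n\<close>.
\<close>

lemma schreier_subset_big_horospheric:
  "schreier_limit_set H T \<subseteq> big_horospheric_limit_set H"
proof
  fix \<omega> assume "\<omega> \<in> schreier_limit_set H T"
  then obtain s where \<omega>: "\<omega> \<in> boundary" and gen: "\<And>n. s n \<in> schreier_generators H T"
    and inv: "\<And>n. s (Suc n) \<noteq> inv\<^bsub>free_group\<^esub> (s n)"
    and lim: "limitin compactification (\<lambda>n. word_point (partial_product s n)) (end_point \<omega>) sequentially"
    by (auto simp: schreier_limit_set_def)
  have "\<exists>g a. (coset g, a) \<notin> arcs T \<and> s n = reduce (tau g @ [a] @ winv (tau (g @ [a])))" for n
    using gen[of n] by (simp only: schreier_generators_iff)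
  then obtain x a where xa: "\<And>n. (coset (x n), a n) \<notin> arcs T"
    and s: "\<And>n. s n = reduce (tau (x n) @ [a n] @ winv (tau (x n @ [a n])))"
    by metis
  define y where "y n = x n @ [a n]" for n
  \<comment> \<open>The label of the tree path from the end of one edge to the start of the
    next.\<close>
  define p where "p n = reduce (winv (tau (y n)) @ tau (x (Suc n)))" for n
  define front where "front = rec_nat (tau (x 0) @ [a 0]) (\<lambda>n w. w @ p n @ [a (Suc n)])"
  have front_0: "front 0 = tau (x 0) @ [a 0]"
    and front_Suc: "front (Suc n) = front n @ p n @ [a (Suc n)]" for n
    by (simp_all add: front_def)
  have last: "front n \<noteq> []" "last (front n) = a n" for n
    by (cases n; simp add: front_0 front_Suc)+
  have s': "s n = reduce (tau (x n) @ [a n] @ winv (tau (y n)))" for n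
    using s by (simp add: y_def)
  have tail: "reduced (a n # winv (tau (y n)))" for n
    using reduced_Cons_winv_tau[OF xa] by (simp add: y_def)
  have tw: "twalk (y n) (p n)" for n
  proof -
    have "twalk (tau (y n)) (winv (tau (y n)))"
      using twalk_winv[OF twalk_tau] by simp
    moreover have "coset (tau (y n) @ winv (tau (y n))) = coset []"
      by (intro coset_reduce_eq) (simp add: reduce_simps)
    ultimately have "twalk (tau (y n)) (winv (tau (y n)) @ tau (x (Suc n)))"
      unfolding twalk_append using twalk_cong[of "tau (y n) @ winv (tau (y n))" "[]"] twalk_tau by blast
    then have "twalk (tau (y n)) (p n)" unfolding p_def by (rule twalk_reduce)
    then show ?thesis by (rule twalk_cong[OF coset_tau, THEN iffD1])
  qed
  have coset_p: "coset (y n @ p n) = coset (x (Suc n))" for n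
  proof -
    have "coset (y n @ p n) = coset (tau (y n) @ p n)"
      by (intro coset_append_cong) simp
    also have "\<dots> = coset (tau (x (Suc n)))"
      unfolding p_def
      by (intro coset_reduce_eq) (simp only: reduce_append_right, simp add: reduce_simps)
    finally show ?thesis by simp
  qed
  have coset_front: "coset (front n) = coset (y n)" for n
  proof (induction n)
    case 0
    show ?case unfolding front_0 y_def by (intro coset_append_cong) simp
  next
    case (Suc n)
    have "coset (front n @ p n @ [a (Suc n)]) = coset ((y n @ p n) @ [a (Suc n)])"
      using coset_append_cong[OF Suc, of "p n @ [a (Suc n)]"] by simp
    also have "\<dots> = coset (y (Suc n))"
      unfolding y_def[of "Suc n"] by (intro coset_append_cong coset_p)
    finally show ?case by (simp add: front_Suc)
  qed
  have prod: "partial_product s (Suc n) = reduce (front n @ winv (tau (y n)))" for n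
  proof (induction n)
    case 0
    show ?case by (simp add: front_0 s' reduce_reduced)
  next
    case (Suc n)
    have "partial_product s (Suc (Suc n)) = reduce (reduce (front n @ winv (tau (y n))) @ s (Suc n))"
      using Suc by simp
    also have "\<dots> = reduce (front n @ (winv (tau (y n)) @ tau (x (Suc n))) @ [a (Suc n)] @ winv (tau (y (Suc n))))"
      unfolding s' by (simp only: reduce_append_left reduce_append_right append_assoc)
    also have "\<dots> = reduce (front n @ p n @ [a (Suc n)] @ winv (tau (y (Suc n))))"
      unfolding p_def by (simp only: reduce_append_mid)
    finally show ?case by (simp add: front_Suc)
  qed
  \<comment> \<open>With an empty tree path in between, cancelling letters belong to mutually
    reversed edges, so the generators are inverse to each other, which \<open>inv\<close>
    excludes.\<close>
  have nocancel: "a (Suc n) \<noteq> inv_letter (a n)" if "p n = []" for n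
  proof
    assume a: "a (Suc n) = inv_letter (a n)"
    have xy: "tau (x (Suc n)) = tau (y n)"
      using coset_p[of n] that by (intro tau_cong) simp
    have "coset (y (Suc n)) = coset (y n @ [inv_letter (a n)])"
      unfolding y_def[of "Suc n"] a using coset_p[of n] that by (intro coset_append_cong) simp
    also have "y n @ [inv_letter (a n)] = x n @ [a n] @ winv [a n]" by (simp add: y_def winv_Cons)
    also have "coset \<dots> = coset (x n)" by (intro coset_reduce_eq) (simp only: reduce_simps)
    finally have yx: "tau (y (Suc n)) = tau (x n)" by (rule tau_cong)
    have "s (Suc n) = reduce (winv (tau (x n) @ [a n] @ winv (tau (y n))))"
      unfolding s'[of "Suc n"] xy yx a by (simp add: winv_append winv_Cons)
    also have "\<dots> = inv\<^bsub>free_group\<^esub> (s n)"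
      by (simp add: s' inv_free_group_winv winv_reduce)
    finally show False using inv by blast
  qed
  have red: "reduced (front n)" for n
  proof (induction n)
    case 0
    show ?case unfolding front_0 by (rule reduced_leave[of "[]"]) (simp_all add: twalk_tau xa)
  next
    case (Suc n)
    have rp: "reduced (p n)" by (simp add: p_def)
    have leave: "reduced (p n @ [a (Suc n)])"
      using tw rp by (rule reduced_leave) (simp add: coset_p xa)
    have "reduced (a n # p n)"
      using xa by (rule reduced_enter) (simp_all add: tw[unfolded y_def] rp)
    then have "hd (p n @ [a (Suc n)]) \<noteq> inv_letter (last (front n))"
      using nocancel[of n] last[of n] by (cases "p n") (auto simp: reduced_Cons)
    then show ?case using Suc leave unfolding front_Suc reduced_append[of "front n"] by blast
  qed
  have prod': "partial_product s (Suc n) = front n @ winv (tau (y n))" for n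
  proof -
    have "reduced (front n @ winv (tau (y n)))"
      using red[of n] tail[of n] last[of n] by (auto simp: reduced_append reduced_Cons)
    then show ?thesis unfolding prod by (rule reduce_reduced)
  qed
  have front_ge: "take (length (front n)) (front m) = front n" if "n \<le> m" for n m
    using that
  proof (induction m rule: dec_induct)
    case (step m)
    then have "length (front n) \<le> length (front m)" by (metis length_take min.cobounded2 min_def nat_le_linear)
    then show ?case using step by (simp add: front_Suc)
  qed simp
  \<comment> \<open>All later partial products begin with \<open>front n\<close>, and they converge
    to \<open>\<omega>\<close>.\<close>
  have init: "front n = initial \<omega> (length (front n))" for n
  proof -
    let ?L = "length (front n)"
    have "reduced (partial_product s m)" for m by (cases m) simp_all
    with lim have "\<forall>\<^sub>F m in sequentially. take ?L (partial_product s m) = initial \<omega> ?L"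
      using limitin_end_point_iff[OF \<omega>, of "partial_product s"] by blast
    then obtain M where M: "\<And>m. m \<ge> M \<Longrightarrow> take ?L (partial_product s m) = initial \<omega> ?L"
      by (auto simp: eventually_sequentially)
    define m where "m = M + n"
    have "?L \<le> length (front m)"
      using arg_cong[OF front_ge[of n m], of length] by (simp add: m_def)
    then have "take ?L (partial_product s (Suc m)) = front n"
      using front_ge[of n m] by (simp only: prod') (simp add: m_def)
    then show ?thesis using M[of "Suc m"] by (simp add: m_def)
  qed
  have in_H: "partial_product s n \<in> H" for n
  proof (induction n)
    case (Suc n)
    then show ?case using generator_closed s by (simp add: mult_closed)
  qed simp
  have "\<exists>h\<in>H \<inter> horoball \<omega> []. L \<le> length h" for L
  proof
    let ?h = "partial_product s (Suc L)"
    \<comment> \<open>Every edge outside the tree contributes a letter, so the elements found are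
      arbitrarily long and hence infinite in number.\<close>
    have long: "n < length (front n)" for n
      by (induction n) (simp_all add: front_0 front_Suc)
    have "length (tau (y L)) \<le> length (front L)"
      using length_tau_le[of "front L"] tau_cong[OF coset_front] by simp
    \<comment> \<open>All of \<open>front L\<close> agrees with \<open>\<omega>\<close>, so the
      Busemann value is at most the length of \<open>tau (y L)\<close> minus that of
      \<open>front L\<close>.\<close>
    moreover have "length (front L) \<le> confluent_length ?h \<omega>"
      using init[of L] by (intro confluent_length_ge) (simp only: prod', simp)
    ultimately have "busemann \<omega> ?h \<le> 0"
      unfolding busemann_def prod' by simp
    then show "?h \<in> H \<inter> horoball \<omega> []"
      using in_H[of "Suc L"] reduced_mem[OF in_H[of "Suc L"]] busemann_initial[of \<omega> 0]
      by (simp add: horoball_eq)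
    show "L \<le> length ?h" using long[of L] by (simp only: prod' length_append)
  qed
  then have "infinite (H \<inter> horoball \<omega> [])" by (rule infinite_if_unbounded_length)
  then show "\<omega> \<in> big_horospheric_limit_set H"
    using \<omega> by (auto simp: big_horospheric_limit_set_def intro!: bexI[of _ "[]"])
qed

end


theorem theorem3p20:
  fixes H :: "('a::finite) word set" and T :: "'a schreier"
  assumes "CARD('a) \<ge> 2"
    and "subgroup H free_group"
    and "H \<noteq> {\<one>\<^bsub>free_group\<^esub>}"
    and "geodesic_spanning_tree H T"
  shows "radial_limit_set H \<subseteq> small_horospheric_limit_set H
    \<and> small_horospheric_limit_set H \<subseteq> schreier_limit_set H T
    \<and> schreier_limit_set H T \<subseteq> big_horospheric_limit_set H
    \<and> big_horospheric_limit_set H \<subseteq> divergence_set H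
    \<and> divergence_set H \<subseteq> limit_set H"
proof (intro conjI)
  interpret schreier_tree H T
    using assms(2,4) by (intro schreier_tree.intro free_subgroup.intro schreier_tree_axioms.intro)
  show "radial_limit_set H \<subseteq> small_horospheric_limit_set H"
    by (rule radial_subset_small_horospheric)
  show "small_horospheric_limit_set H \<subseteq> schreier_limit_set H T"
    by (rule small_horospheric_subset_schreier)
  show "schreier_limit_set H T \<subseteq> big_horospheric_limit_set H"
    by (rule schreier_subset_big_horospheric)
  show "big_horospheric_limit_set H \<subseteq> divergence_set H"
    by (rule big_horospheric_subset_divergence_set)
  show "divergence_set H \<subseteq> limit_set H"
    using assms(2) by (rule divergence_set_subset_limit_set)
qed

end
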